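(* Let $\mathcal{G}$ be a finite abelian group, let $\mathcal{D}$ be a nonempty difference set for $\mathcal{G}$ that is $\mathcal{H}$-fine for a subgroup $\mathcal{H}$ of $\mathcal{G}$, and let $G=\#(\mathcal{G})$, $D=\#(\mathcal{D})$, $S=\left[\frac{D(G-1)}{G-D}\right]^{1/2}$. For $g\in\mathcal{G}$ let $\mathcal{D}_g:=\mathcal{H}\cap(\mathcal{D}-g)$. For $\gamma\in\hat{\mathcal{G}}$ define the matrix $\mathbf{\Phi}_\gamma\in\mathbb{C}^{\mathcal{D}\times\mathcal{H}^\perp}$ by $\mathbf{\Phi}_\gamma(d,\gamma')=\frac{1}{\sqrt{D}}\gamma(d)\gamma'(d)$, define $\mathbf{\Psi}\in\mathbb{C}^{((\mathcal{G}/\mathcal{H})\setminus\{\overline{0}\})\times\mathcal{H}^\perp}$ by $\mathbf{\Psi}(\overline{g},\gamma)=\frac{1}{\sqrt{S}}\gamma(g)$, and define $$\mathbf{E}_\gamma\in\mathbb{C}^{\mathcal{D}\times((\mathcal{G}/\mathcal{H})\setminus\{\overline{0}\})},\qquad \mathbf{E}_\gamma(d,\overline{g})=\frac{\sqrt{S}}{\sqrt{D}}\begin{cases}\gamma(d),&\overline{d}=\overline{g},\\0,&\overline{d}\neq\overline{g}.\end{cases}$$ Then: (a) For any $\gamma,\gamma'\in\hat{\mathcal{G}}$, $\mathbf{E}_\gamma^*\mathbf{E}_{\gamma'}$ is a diagonal matrix whose diagonal entries are given by $$(\mathbf{E}_\gamma^*\mathbf{E}_{\gamma'})(\overline{g},\overline{g})=\frac{S}{D}\sum_{d\in\mathcal{D},\,\overline{d}=\overline{g}}(\gamma^{-1}\gamma')(d),\qquad\forall\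 \overline{g}\in(\mathcal{G}/\mathcal{H})\setminus\{\overline{0}\}.$$ Moreover, for any $\gamma\in\hat{\mathcal{G}}$, $\mathbf{E}_\gamma$ is an isometry, that is, $\mathbf{E}_\gamma^*\mathbf{E}_\gamma=\mathbf{I}$, and satisfies $\mathbf{\Phi}_\gamma=\mathbf{E}_\gamma\mathbf{\Psi}$. (b) The sequence of subspaces $\{\mathcal{U}_{\overline{\gamma}}\}_{\overline{\gamma}\in\hat{\mathcal{G}}/\mathcal{H}^\perp}$, where $\mathcal{U}_{\overline{\gamma}}$ is the column space of $\mathbf{\Phi}_\gamma$, is an equi-isoclinic tight fusion frame (EITFF) for $\mathbb{C}^{\mathcal{D}}$ if and only if every $\mathcal{D}_g$ ($g\in\mathcal{G}$) is a difference set for $\mathcal{H}$. In this case, $S^3$ necessarily divides $D^2$. (c) If every $\mathcal{D}_g$ is a difference set for $\mathcal{H}$, then for every $\gamma\notin\mathcal{H}^\perp$, the $(\mathcal{G}/\mathcal{H})$-circulant matrix $$\mathbf{C}_\gamma\in\mathbb{C}^{(\mathcal{G}/\mathcal{H})\times(\mathcal{G}/\mathcal{H})},\qquad \mathbf{C}_\gamma(\overline{g},\overline{g}')=\frac{S^{3/2}}{D}\sum_{d\in\mathcal{D},\,\overline{d}=\overline{g}-\overline{g}'}\gamma(d),$$ is a conference matrix, that is, satisfies $\mathbf{C}_\gamma^*\mathbf{C}_\gamma=S\mathbf{I}$ where $|\mathbf{C}_\gamma(\overline{g},\overline{g}')|=0$ if $\overline{g}=\overline{g}'$ and $|\mathbf{C}_\gamma(\overline{g},\overline{g}')|=1$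 if $\overline{g}\neq\overline{g}'$.
   Context: Groups $\mathcal{G}$ are written additively. A subset $\mathcal{D}$ of a finite abelian group $\mathcal{G}$ is a difference set for $\mathcal{G}$ if every nonzero $g\in\mathcal{G}$ can be written as $g=d-d'$ with $(d,d')\in\mathcal{D}\times\mathcal{D}$ in the same number of ways. (The empty set is trivially a difference set; the sets $\mathcal{D}_g$ may be empty.) A nonempty $D$-element difference set $\mathcal{D}$ for an abelian group $\mathcal{G}$ of order $G$ is $\mathcal{H}$-fine, for a subgroup $\mathcal{H}$ of $\mathcal{G}$, if $\mathcal{D}\cap\mathcal{H}=\emptyset$ and $\mathcal{H}$ has order $\frac{G}{S+1}$, where $S=\left[\frac{D(G-1)}{G-D}\right]^{1/2}$. (For such $\mathcal{D}$, $S$ is an integer dividing $D$.) $\hat{\mathcal{G}}$ is the multiplicative group of characters (homomorphisms) $\gamma:\mathcal{G}\to\{z\in\mathbb{C}:|z|=1\}$, and $\mathcal{H}^\perp=\{\gamma\in\hat{\mathcal{G}}:\gamma(h)=1\ \forall h\in\mathcal{H}\}$. Cosets are denoted $\overline{g}=g+\mathcal{H}\in\mathcal{G}/\mathcal{H}$ and $\overline{\gamma}=\gamma\mathcal{H}^\perp\in\hat{\mathcal{G}}/\mathcal{H}^\perp$. The matrix $\mathbf{\Psi}$ is well defined since members of $\mathcal{H}^\perp$ are constant on cosets of $\mathcal{H}$, and the column space of $\mathbf{\Phi}_\gamma$ depends only on $\overline{\gamma}$. The symbol $*$ on matrices denotes conjugate transpose. A $(\mathcal{G}/\mathcal{H})$-circulant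 matrix is one whose $(\overline{g},\overline{g}')$ entry depends only on $\overline{g}-\overline{g}'$. A finite sequence $\{\mathcal{U}_n\}_{n\in\mathcal{N}}$ of subspaces of equal dimension of a finite-dimensional complex Hilbert space $\mathbb{H}$, with orthogonal projection operators $\{\mathbf{P}_n\}_{n\in\mathcal{N}}$, is a tight fusion frame for $\mathbb{H}$ if $\sum_{n\in\mathcal{N}}\mathbf{P}_n=C\mathbf{I}$ for some $C>0$. It is an EITFF for $\mathbb{H}$ if it is a tight fusion frame for $\mathbb{H}$ and there is some $\sigma\geq0$ such that $\mathbf{P}_n\mathbf{P}_{n'}\mathbf{P}_n=\sigma^2\mathbf{P}_n$ for all $n\neq n'$.
   Formalization: In (b), the claim that S^3 divides D^2 is stated only for nontrivial H; for H = {0} it fails, e.g. G = Z/3, D = {1,2}, where S = 2 and 8 does not divide 4. *)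

theory Defs
  imports Complex_Main "HOL-Library.Function_Algebras" "HOL-Algebra.Coset"
begin

text \<open>
  Abelian groups are those of HOL-Algebra, hence written multiplicatively: \<open>g - g'\<close> becomes
  \<open>g \<otimes> inv g'\<close>, the coset \<open>g + H\<close> becomes \<open>H #> g\<close>, and the zero coset is \<open>\<one>\<close> of
  \<open>G Mod H\<close>.  A subgroup \<open>H\<close>, viewed as a group, is \<open>G\<lparr>carrier := H\<rparr>\<close>.
\<close>

subsection \<open>Difference sets\<close>

definition difference_set :: "('a, 'b) monoid_scheme \<Rightarrow> 'a set \<Rightarrow> bool" where
  "difference_set G D \<longleftrightarrow> D \<subseteq> carrier G \<and>
     (\<exists>l::nat. \<forall>g \<in> carrier G - {\<one>\<^bsub>G\<^esub>}.
        card {(d, d') \<in> D \<times> D. g = d \<otimes>\<^bsub>G\<^esub> inv\<^bsub>G\<^esub> d'} = l)"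

definition fine_S :: "('a, 'b) monoid_scheme \<Rightarrow> 'a set \<Rightarrow> real" where
  "fine_S G D = sqrt (real (card D) * (real (order G) - 1) / (real (order G) - real (card D)))"

definition fine_difference_set :: "('a, 'b) monoid_scheme \<Rightarrow> 'a set \<Rightarrow> 'a set \<Rightarrow> bool" where
  "fine_difference_set G H D \<longleftrightarrow> difference_set G D \<and> D \<noteq> {} \<and> D \<inter> H = {} \<and>
     real (card H) = real (order G) / (fine_S G D + 1)"

definition shifted_part :: "('a, 'b) monoid_scheme \<Rightarrow> 'a set \<Rightarrow> 'a set \<Rightarrow> 'a \<Rightarrow> 'a set" where
  "shifted_part G H D g = H \<inter> (D #>\<^bsub>G\<^esub> inv\<^bsub>G\<^esub> g)"

subsection \<open>Characters\<close>

definition circle_group :: "complex monoid" where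
  "circle_group = \<lparr>carrier = {z. cmod z = 1}, mult = (*), one = 1\<rparr>"

text \<open>Characters are extensional, so that equality of functions is equality of characters.\<close>

definition dual_group :: "('a, 'b) monoid_scheme \<Rightarrow> ('a \<Rightarrow> complex) monoid" where
  "dual_group G =
     \<lparr>carrier = hom G circle_group \<inter> extensional (carrier G),
      mult = (\<lambda>\<gamma> \<gamma>'. restrict (\<lambda>g. \<gamma> g * \<gamma>' g) (carrier G)),
      one = restrict (\<lambda>_. 1) (carrier G)\<rparr>"

definition annihilator :: "('a, 'b) monoid_scheme \<Rightarrow> 'a set \<Rightarrow> ('a \<Rightarrow> complex) set" where
  "annihilator G H = {\<gamma> \<in> carrier (dual_group G). \<forall>h\<in>H. \<gamma> h = 1}"

subsection \<open>Matrices indexed by finite sets\<close>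

text \<open>
  A matrix with rows in \<open>I\<close> and columns in \<open>J\<close> is a function of two arguments of which only the
  values on \<open>I \<times> J\<close> matter.  The index set in \<open>mat_times\<close> is the one summed over.
\<close>

definition mat_eq :: "'i set \<Rightarrow> 'j set \<Rightarrow> ('i \<Rightarrow> 'j \<Rightarrow> complex) \<Rightarrow> ('i \<Rightarrow> 'j \<Rightarrow> complex) \<Rightarrow> bool" where
  "mat_eq I J A B \<longleftrightarrow> (\<forall>i\<in>I. \<forall>j\<in>J. A i j = B i j)"

definition mat_times ::
  "'k set \<Rightarrow> ('i \<Rightarrow> 'k \<Rightarrow> complex) \<Rightarrow> ('k \<Rightarrow> 'j \<Rightarrow> complex) \<Rightarrow> 'i \<Rightarrow> 'j \<Rightarrow> complex" where
  "mat_times K A B = (\<lambda>i j. \<Sum>k\<in>K. A i k * B k j)"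

definition conj_transpose :: "('i \<Rightarrow> 'j \<Rightarrow> complex) \<Rightarrow> 'j \<Rightarrow> 'i \<Rightarrow> complex" where
  "conj_transpose A = (\<lambda>j i. cnj (A i j))"

definition scalar_mat :: "complex \<Rightarrow> 'i \<Rightarrow> 'i \<Rightarrow> complex" where
  "scalar_mat c = (\<lambda>i j. if i = j then c else 0)"

definition diagonal_on :: "'i set \<Rightarrow> ('i \<Rightarrow> 'i \<Rightarrow> complex) \<Rightarrow> bool" where
  "diagonal_on I A \<longleftrightarrow> (\<forall>i\<in>I. \<forall>j\<in>I. i \<noteq> j \<longrightarrow> A i j = 0)"

definition circulant :: "('q, 'b) monoid_scheme \<Rightarrow> ('q \<Rightarrow> 'q \<Rightarrow> complex) \<Rightarrow> bool" where
  "circulant Q A \<longleftrightarrow>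
     (\<exists>f. \<forall>x\<in>carrier Q. \<forall>y\<in>carrier Q. A x y = f (x \<otimes>\<^bsub>Q\<^esub> inv\<^bsub>Q\<^esub> y))"

definition conference_matrix :: "'i set \<Rightarrow> real \<Rightarrow> ('i \<Rightarrow> 'i \<Rightarrow> complex) \<Rightarrow> bool" where
  "conference_matrix I s A \<longleftrightarrow>
     mat_eq I I (mat_times I (conj_transpose A) A) (scalar_mat (complex_of_real s)) \<and>
     (\<forall>i\<in>I. \<forall>j\<in>I. cmod (A i j) = (if i = j then 0 else 1))"

subsection \<open>Subspaces of \<open>\<complex>\<^sup>I\<close> and fusion frames\<close>

definition cscale :: "complex \<Rightarrow> ('i \<Rightarrow> complex) \<Rightarrow> 'i \<Rightarrow> complex" where
  "cscale c v = (\<lambda>i. c * v i)"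

global_interpretation cfun: vector_space "cscale :: complex \<Rightarrow> ('i \<Rightarrow> complex) \<Rightarrow> 'i \<Rightarrow> complex"
  by unfold_locales (auto simp: cscale_def fun_eq_iff algebra_simps)

text \<open>\<open>\<complex>\<^sup>I\<close> is realised as the functions vanishing outside \<open>I\<close>.\<close>

definition cspace :: "'i set \<Rightarrow> ('i \<Rightarrow> complex) set" where
  "cspace I = {v. \<forall>i. i \<notin> I \<longrightarrow> v i = 0}"

definition cdot :: "'i set \<Rightarrow> ('i \<Rightarrow> complex) \<Rightarrow> ('i \<Rightarrow> complex) \<Rightarrow> complex" where
  "cdot I v w = (\<Sum>i\<in>I. cnj (v i) * w i)"

definition orth_proj :: "'i set \<Rightarrow> ('i \<Rightarrow> complex) set \<Rightarrow> ('i \<Rightarrow> complex) \<Rightarrow> 'i \<Rightarrow> complex" where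
  "orth_proj I U v = (THE p. p \<in> U \<and> (\<forall>u\<in>U. cdot I u (v - p) = 0))"

definition column_space :: "'i set \<Rightarrow> 'j set \<Rightarrow> ('i \<Rightarrow> 'j \<Rightarrow> complex) \<Rightarrow> ('i \<Rightarrow> complex) set" where
  "column_space I J A = cfun.span ((\<lambda>j i. if i \<in> I then A i j else 0) ` J)"

definition tight_fusion_frame :: "'i set \<Rightarrow> 'n set \<Rightarrow> ('n \<Rightarrow> ('i \<Rightarrow> complex) set) \<Rightarrow> bool" where
  "tight_fusion_frame I N U \<longleftrightarrow> finite I \<and> finite N \<and>
     (\<forall>n\<in>N. cfun.subspace (U n) \<and> U n \<subseteq> cspace I) \<and>
     (\<forall>n\<in>N. \<forall>n'\<in>N. cfun.dim (U n) = cfun.dim (U n')) \<and>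
     (\<exists>C::real. C > 0 \<and>
        (\<forall>v\<in>cspace I. (\<Sum>n\<in>N. orth_proj I (U n) v) = cscale (complex_of_real C) v))"

definition eitff :: "'i set \<Rightarrow> 'n set \<Rightarrow> ('n \<Rightarrow> ('i \<Rightarrow> complex) set) \<Rightarrow> bool" where
  "eitff I N U \<longleftrightarrow> tight_fusion_frame I N U \<and>
     (\<exists>\<sigma>::real. \<sigma> \<ge> 0 \<and>
        (\<forall>n\<in>N. \<forall>n'\<in>N. n \<noteq> n' \<longrightarrow>
          (\<forall>v\<in>cspace I.
             orth_proj I (U n) (orth_proj I (U n') (orth_proj I (U n) v)) =
             cscale (complex_of_real (\<sigma>\<^sup>2)) (orth_proj I (U n) v))))"

subsection \<open>The matrices attached to a fine difference set\<close>

definition nonzero_cosets :: "('a, 'b) monoid_scheme \<Rightarrow> 'a set \<Rightarrow> 'a set set" where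
  "nonzero_cosets G H = carrier (G Mod H) - {\<one>\<^bsub>G Mod H\<^esub>}"

definition Phi_mat ::
  "'a set \<Rightarrow> ('a \<Rightarrow> complex) \<Rightarrow> 'a \<Rightarrow> ('a \<Rightarrow> complex) \<Rightarrow> complex" where
  "Phi_mat D \<gamma> = (\<lambda>d \<gamma>'. complex_of_real (1 / sqrt (real (card D))) * (\<gamma> d * \<gamma>' d))"

definition Psi_mat ::
  "('a, 'b) monoid_scheme \<Rightarrow> 'a set \<Rightarrow> 'a set \<Rightarrow> ('a \<Rightarrow> complex) \<Rightarrow> complex" where
  "Psi_mat G D = (\<lambda>c \<gamma>. complex_of_real (1 / sqrt (fine_S G D)) * \<gamma> (SOME g. g \<in> c))"

definition E_mat ::
  "('a, 'b) monoid_scheme \<Rightarrow> 'a set \<Rightarrow> 'a set \<Rightarrow> ('a \<Rightarrow> complex) \<Rightarrow> 'a \<Rightarrow> 'a set \<Rightarrow> complex" where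
  "E_mat G H D \<gamma> = (\<lambda>d c. complex_of_real (sqrt (fine_S G D) / sqrt (real (card D))) *
     (if H #>\<^bsub>G\<^esub> d = c then \<gamma> d else 0))"

definition C_mat ::
  "('a, 'b) monoid_scheme \<Rightarrow> 'a set \<Rightarrow> 'a set \<Rightarrow> ('a \<Rightarrow> complex) \<Rightarrow> 'a set \<Rightarrow> 'a set \<Rightarrow> complex" where
  "C_mat G H D \<gamma> = (\<lambda>c c'. complex_of_real (fine_S G D powr (3/2) / real (card D)) *
     (\<Sum>d | d \<in> D \<and> H #>\<^bsub>G\<^esub> d = c \<otimes>\<^bsub>G Mod H\<^esub> inv\<^bsub>G Mod H\<^esub> c'. \<gamma> d))"

definition U_space ::
  "('a, 'b) monoid_scheme \<Rightarrow> 'a set \<Rightarrow> 'a set \<Rightarrow> ('a \<Rightarrow> complex) set \<Rightarrow> ('a \<Rightarrow> complex) set" where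
  "U_space G H D \<Gamma> = column_space D (annihilator G H) (Phi_mat D (SOME \<gamma>. \<gamma> \<in> \<Gamma>))"

text \<open>The choices of representatives in \<open>Psi_mat\<close> and \<open>U_space\<close> are immaterial.\<close>

lemma annihilator_coset_eq:
  assumes "group G" "subgroup H G" "g \<in> carrier G" "\<gamma> \<in> annihilator G H"
    and "x \<in> H #>\<^bsub>G\<^esub> g"
  shows "\<gamma> x = \<gamma> g"
proof -
  obtain h where h: "h \<in> H" "x = h \<otimes>\<^bsub>G\<^esub> g"
    using assms(5) by (auto simp: r_coset_def)
  have "h \<in> carrier G"
    using h assms(2) by (meson subgroup.mem_carrier)
  moreover have "\<gamma> \<in> hom G circle_group" "\<gamma> h = 1"
    using assms(4) h by (auto simp: annihilator_def dual_group_def)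
  ultimately show ?thesis
    using h assms(3) by (simp add: hom_def circle_group_def)
qed

lemma Psi_mat_coset:
  assumes "group G" "subgroup H G" "g \<in> carrier G" "\<gamma> \<in> annihilator G H"
  shows "Psi_mat G D (H #>\<^bsub>G\<^esub> g) \<gamma> = complex_of_real (1 / sqrt (fine_S G D)) * \<gamma> g"
proof -
  have "g \<in> H #>\<^bsub>G\<^esub> g"
    using assms by (simp add: group.rcos_self)
  then have "(SOME x. x \<in> H #>\<^bsub>G\<^esub> g) \<in> H #>\<^bsub>G\<^esub> g"
    by (rule someI)
  then show ?thesis
    using annihilator_coset_eq[OF assms] by (simp add: Psi_mat_def)
qed

lemma dual_group_mult:
  "g \<in> carrier G \<Longrightarrow> (\<gamma> \<otimes>\<^bsub>dual_group G\<^esub> \<gamma>') g = \<gamma> g * \<gamma>' g"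
  by (simp add: dual_group_def)

lemma comm_group_dual_group:
  assumes "comm_group G"
  shows "comm_group (dual_group G)"
proof -
  interpret G: comm_group G by fact
  show ?thesis
  proof (rule comm_groupI)
    fix x assume x: "x \<in> carrier (dual_group G)"
    define y where "y = restrict (\<lambda>g. cnj (x g)) (carrier G)"
    have "y \<in> carrier (dual_group G)"
      using x by (auto simp: y_def dual_group_def hom_def circle_group_def)
    moreover have "y \<otimes>\<^bsub>dual_group G\<^esub> x = \<one>\<^bsub>dual_group G\<^esub>"
    proof
      fix g
      have "cnj (x g) * x g = 1" if "g \<in> carrier G"
        using that x complex_norm_square[of "x g"]
        by (auto simp: dual_group_def hom_def circle_group_def mult.commute Pi_def)
      then show "(y \<otimes>\<^bsub>dual_group G\<^esub> x) g = \<one>\<^bsub>dual_group G\<^esub> g"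
        by (auto simp: y_def dual_group_def)
    qed
    ultimately show "\<exists>y\<in>carrier (dual_group G). y \<otimes>\<^bsub>dual_group G\<^esub> x = \<one>\<^bsub>dual_group G\<^esub>"
      by blast
  qed (auto simp: dual_group_def hom_def circle_group_def fun_eq_iff norm_mult Pi_def
        extensional_def)
qed

lemma subgroup_annihilator:
  assumes "comm_group G" "subgroup H G"
  shows "subgroup (annihilator G H) (dual_group G)"
proof -
  interpret G: comm_group G by fact
  interpret A: comm_group "dual_group G" by (rule comm_group_dual_group) fact
  have H: "h \<in> carrier G" if "h \<in> H" for h
    using that assms(2) by (meson subgroup.mem_carrier)
  have one: "\<one>\<^bsub>dual_group G\<^esub> h = 1" if "h \<in> H" for h
    using H[OF that] by (simp add: dual_group_def)
  show ?thesis
  proof (rule A.subgroupI)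
    show "annihilator G H \<noteq> {}"
      using one A.one_closed by (auto simp: annihilator_def)
  next
    fix a assume a: "a \<in> annihilator G H"
    then have ac: "a \<in> carrier (dual_group G)"
      by (simp add: annihilator_def)
    have "(inv\<^bsub>dual_group G\<^esub> a) h = 1" if h: "h \<in> H" for h
    proof -
      have "(inv\<^bsub>dual_group G\<^esub> a \<otimes>\<^bsub>dual_group G\<^esub> a) h = 1"
        using ac one[OF h] by simp
      then show ?thesis
        using a h H[OF h] by (simp add: dual_group_mult annihilator_def)
    qed
    then show "inv\<^bsub>dual_group G\<^esub> a \<in> annihilator G H"
      using ac by (simp add: annihilator_def)
  qed (auto simp: annihilator_def dual_group_mult H)
qed

lemma U_space_coset:
  assumes "comm_group G" "subgroup H G" "D \<subseteq> carrier G" "\<gamma> \<in> carrier (dual_group G)"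
  shows "U_space G H D (annihilator G H #>\<^bsub>dual_group G\<^esub> \<gamma>) =
         column_space D (annihilator G H) (Phi_mat D \<gamma>)"
proof -
  let ?A = "annihilator G H" and ?X = "dual_group G"
  interpret A: comm_group ?X by (rule comm_group_dual_group) fact
  have sub: "subgroup ?A ?X"
    by (rule subgroup_annihilator) fact+
  define \<delta> where "\<delta> = (SOME \<delta>. \<delta> \<in> ?A #>\<^bsub>?X\<^esub> \<gamma>)"
  have "\<gamma> \<in> ?A #>\<^bsub>?X\<^esub> \<gamma>"
    using assms sub by (simp add: A.rcos_self)
  then have "\<delta> \<in> ?A #>\<^bsub>?X\<^esub> \<gamma>"
    unfolding \<delta>_def by (rule someI[where P = "\<lambda>\<delta>. \<delta> \<in> _"])
  then obtain a where a: "a \<in> ?A" "\<delta> = a \<otimes>\<^bsub>?X\<^esub> \<gamma>"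
    by (auto simp: r_coset_def)
  let ?col = "\<lambda>\<gamma> j i. if i \<in> D then Phi_mat D \<gamma> i j else 0"
  have shift: "?col \<delta> \<chi> = ?col \<gamma> (a \<otimes>\<^bsub>?X\<^esub> \<chi>)" for \<chi>
  proof
    fix i
    show "?col \<delta> \<chi> i = ?col \<gamma> (a \<otimes>\<^bsub>?X\<^esub> \<chi>) i"
      using subsetD[OF assms(3), of i] by (simp add: a(2) Phi_mat_def dual_group_mult)
  qed
  have "(\<lambda>\<chi>. a \<otimes>\<^bsub>?X\<^esub> \<chi>) ` ?A = ?A"
    using A.coset_join3[OF subgroup.mem_carrier[OF sub a(1)] sub a(1)]
    unfolding l_coset_def by blast
  then have "?col \<gamma> ` ?A = ?col \<gamma> ` ((\<lambda>\<chi>. a \<otimes>\<^bsub>?X\<^esub> \<chi>) ` ?A)"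
    by (rule arg_cong[OF sym])
  also have "\<dots> = ?col \<delta> ` ?A"
    unfolding image_image shift ..
  finally show ?thesis
    unfolding U_space_def column_space_def \<delta>_def by (rule arg_cong[OF sym])
qed

text \<open>
  The definition of a fine difference set does not exclude the trivial subgroup: then \<open>D\<close> is
  the complement of the identity, all \<open>shifted_part G H D g\<close> are difference sets for \<open>H\<close>, and
  \<open>S = card D\<close>.  Hence \<open>S ^ 3\<close> divides \<open>(card D)\<^sup>2\<close> only if \<open>card D = 1\<close>, and this divisibility
  can be claimed for nontrivial \<open>H\<close> only.
\<close>

lemma fine_difference_set_trivial_subgroup:
  assumes "comm_group G" "finite (carrier G)" "order G \<ge> 2"
  defines "D \<equiv> carrier G - {\<one>\<^bsub>G\<^esub>}"
  shows "fine_difference_set G {\<one>\<^bsub>G\<^esub>} D"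
    and "difference_set (G\<lparr>carrier := {\<one>\<^bsub>G\<^esub>}\<rparr>) (shifted_part G {\<one>\<^bsub>G\<^esub>} D g)"
    and "fine_S G D = real (card D)"
proof -
  interpret G: comm_group G by fact
  have cardD: "card D = order G - 1"
    using assms(2) by (simp add: D_def order_def)
  have "real (card D) * (real (order G) - 1) / (real (order G) - real (card D)) = (real (card D))\<^sup>2"
    using cardD assms(3) by (simp add: power2_eq_square of_nat_diff)
  then show S: "fine_S G D = real (card D)"
    by (simp add: fine_S_def)
  show "difference_set (G\<lparr>carrier := {\<one>\<^bsub>G\<^esub>}\<rparr>) (shifted_part G {\<one>\<^bsub>G\<^esub>} D g)"
    by (auto simp: difference_set_def shifted_part_def)
  have "card {(d, d') \<in> D \<times> D. g = d \<otimes>\<^bsub>G\<^esub> inv\<^bsub>G\<^esub> d'} = order G - 2"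
    if g: "g \<in> carrier G - {\<one>\<^bsub>G\<^esub>}" for g
  proof -
    let ?K = "carrier G - {\<one>\<^bsub>G\<^esub>, inv\<^bsub>G\<^esub> g}"
    have eq: "{(d, d') \<in> D \<times> D. g = d \<otimes>\<^bsub>G\<^esub> inv\<^bsub>G\<^esub> d'} = (\<lambda>x. (g \<otimes>\<^bsub>G\<^esub> x, x)) ` ?K"
      (is "?L = ?R")
    proof (intro equalityI subsetI)
      fix p assume "p \<in> ?L"
      then obtain d d' where p: "p = (d, d')" "d \<in> D" "d' \<in> D" "g = d \<otimes>\<^bsub>G\<^esub> inv\<^bsub>G\<^esub> d'"
        by auto
      then have d: "d = g \<otimes>\<^bsub>G\<^esub> d'"
        by (simp add: D_def G.m_assoc)
      moreover have "d' \<noteq> inv\<^bsub>G\<^esub> g"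
      proof
        assume "d' = inv\<^bsub>G\<^esub> g"
        then have "d = \<one>\<^bsub>G\<^esub>"
          using d g by simp
        then show False
          using p(2) by (simp add: D_def)
      qed
      ultimately show "p \<in> ?R"
        using p by (auto simp: D_def)
    next
      fix p assume "p \<in> ?R"
      then obtain x where x: "p = (g \<otimes>\<^bsub>G\<^esub> x, x)" "x \<in> carrier G" "x \<noteq> \<one>\<^bsub>G\<^esub>" "x \<noteq> inv\<^bsub>G\<^esub> g"
        by auto
      moreover have "g \<otimes>\<^bsub>G\<^esub> x \<noteq> \<one>\<^bsub>G\<^esub>"
        using x g G.inv_equality[of x g] G.m_comm[of x g] by auto
      ultimately show "p \<in> ?L"
        using g by (simp add: D_def G.m_assoc)
    qed
    have "inv\<^bsub>G\<^esub> g \<noteq> \<one>\<^bsub>G\<^esub>"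
      using g by (metis DiffD1 DiffD2 G.inv_inv G.inv_one singletonI)
    then have "card {\<one>\<^bsub>G\<^esub>, inv\<^bsub>G\<^esub> g} = 2"
      using card_2_iff by metis
    then have "card ?K = order G - 2"
      using g assms(2) by (subst card_Diff_subset) (auto simp: order_def)
    moreover have "card ?R = card ?K"
      by (rule card_image) (auto simp: inj_on_def)
    ultimately show ?thesis
      unfolding eq by simp
  qed
  then have "difference_set G D"
    unfolding difference_set_def D_def[symmetric] by (auto simp: D_def)
  moreover have "D \<noteq> {}"
    using cardD assms(3) by auto
  ultimately show "fine_difference_set G {\<one>\<^bsub>G\<^esub>} D"
    using S cardD assms(3) by (auto simp: fine_difference_set_def D_def of_nat_diff)
qed

end

theory Submission
  imports Defs "HOL-Algebra.Multiplicative_Group"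
begin

text \<open>
  Counting pairs of \<open>D\<close> with difference in \<open>H\<close> shows that \<open>D\<close> meets every nonzero coset of \<open>H\<close> in
  \<open>D / S\<close> points. Hence the \<open>E\<^sub>\<gamma>\<close> are isometries, and since the rows of \<open>\<Psi>\<close> are orthogonal, \<open>\<Phi>\<^sub>\<gamma>\<close> and
  \<open>E\<^sub>\<gamma>\<close> have the same column space, with projection \<open>E\<^sub>\<gamma> E\<^sub>\<gamma>\<^sup>*\<close>. Tightness is the orthogonality of the
  characters of \<open>G\<close>. As \<open>E\<^sub>\<gamma>\<^sup>* E\<^sub>\<delta>\<close> is diagonal, the subspaces are equi-isoclinic iff the moduli of
  the character sums of all \<open>D\<^sub>g\<close>, \<open>g \<notin> H\<close>, over all characters nontrivial on \<open>H\<close> are equal. For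
  difference sets \<open>D\<^sub>g\<close> with parameter \<open>\<lambda>\<close> their square is \<open>D / S - \<lambda> = D\<^sup>2 / S\<^sup>3\<close>, an integer;
  conversely Fourier inversion gives the difference counts of \<open>D\<^sub>g\<close> back. The columns of \<open>C\<^sub>\<gamma>\<close> are
  orthogonal because \<open>D\<close> is a difference set.
\<close>

section \<open>Characters of finite abelian groups\<close>

text \<open>The sets \<open>D_g\<close> are subsets of \<open>H\<close>, while the frame only sees
  characters of \<open>G\<close>. The dual of \<open>H\<close> is never formed: characters of
  \<open>G\<close> restricted to \<open>H\<close> take its place, and those with trivial restriction
  form the annihilator. Fourier inversion for \<open>D_g\<close> therefore runs over the dual of
  \<open>G\<close>, where the annihilator contributes a known constant. That the dual of
  \<open>G\<close> is large enough comes from extending characters of subgroups by one element at a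
  time.

  The value of S enters through one identity, |H| (S^2 - D) = D (S - 1). It makes the variance of
  the coset intersections vanish, and for k = D / S it turns k^2 = k + \<lambda> (|H| - 1) into S (k
  - \<lambda>) = k^2, the source of \<open>D\<^sup>2 / S\<^sup>3\<close>. The last step cancels |H|
  - 1. For trivial \<open>H\<close> it breaks down: \<lambda> is then arbitrary, every character
  lies in the annihilator, there is a single subspace, and all conditions on other characters are
  vacuous. Hence the divisibility claim excludes this case.\<close>

lemma (in group) rcos_eq_iff:
  assumes "subgroup H G" "x \<in> carrier G" "y \<in> carrier G"
  shows "H #> x = H #> y \<longleftrightarrow> x \<otimes> inv y \<in> H"
  using assms subgroup.rcos_module[OF assms(1) is_group assms(3,2)] repr_independence[of x H y]
    repr_independenceD[of H x y] by blast

locale finite_comm_group = comm_group G for G (structure) +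
  assumes finite_carrier [simp]: "finite (carrier G)"

text \<open>A character of a subgroup is kept as a function on the whole type with arbitrary values
  off \<open>K\<close>, so an extension only has to agree on \<open>K\<close>. Since
  \<open>subgroup K G\<close> is part of the predicate, the pair \<open>K\<close>, \<open>f\<close>
  passes through the extension argument as one fact.\<close>

definition unitary_char_on :: "('a, 'b) monoid_scheme \<Rightarrow> 'a set \<Rightarrow> ('a \<Rightarrow> complex) \<Rightarrow> bool" where
  "unitary_char_on G K f \<longleftrightarrow> subgroup K G \<and> (\<forall>a\<in>K. cmod (f a) = 1) \<and>
     (\<forall>a\<in>K. \<forall>b\<in>K. f (a \<otimes>\<^bsub>G\<^esub> b) = f a * f b)"

context finite_comm_group
begin

section \<open>Extension of characters from subgroups\<close>

lemma order_pos: "order G > 0"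
  using finite_carrier by (auto simp: order_def card_gt_0_iff)

lemma unitary_char_on_pow:
  assumes "unitary_char_on G K f" "a \<in> K"
  shows "f (a [^] (n::nat)) = f a ^ n"
proof -
  have K: "subgroup K G"
    using assms by (simp add: unitary_char_on_def)
  then have "cmod (f \<one>) = 1" and "f (\<one> \<otimes> \<one>) = f \<one> * f \<one>"
    using assms subgroup.one_closed[OF K] by (simp_all only: unitary_char_on_def)
  \<comment> \<open>An idempotent of modulus 1 is 1.\<close>
  then have one: "f \<one> = 1"
    by auto
  have "a [^] n \<in> K \<and> f (a [^] n) = f a ^ n"
  proof (induction n)
    case 0
    then show ?case using one subgroup.one_closed[OF K] by simp
  next
    case (Suc n)
    then show ?case
      using assms by (simp add: unitary_char_on_def subgroup.m_closed[OF K])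
  qed
  then show ?thesis ..
qed

text \<open>
  Adjoining \<open>x\<close> to \<open>K\<close>: the value \<open>z\<close> at \<open>x\<close> is only constrained by the first power \<open>m\<close> of \<open>x\<close> in \<open>K\<close>,
  since \<open>x [^] j \<in> K\<close> forces \<open>m\<close> to divide \<open>j\<close>.
\<close>

lemma unitary_char_on_extend:
  assumes f: "unitary_char_on G K f" and x: "x \<in> carrier G"
    and m: "m > 0" "x [^] m \<in> K" "\<And>i. 0 < i \<Longrightarrow> i < m \<Longrightarrow> x [^] i \<notin> K"
    and z: "z ^ m = f (x [^] (m::nat))"
  shows "\<exists>K' f'. unitary_char_on G K' f' \<and> K \<subseteq> K' \<and> x \<in> K' \<and> (\<forall>a\<in>K. f' a = f a) \<and> f' x = z"
proof -
  have K: "subgroup K G" and norm: "\<And>a. a \<in> K \<Longrightarrow> cmod (f a) = 1"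
    and mult: "\<And>a b. a \<in> K \<Longrightarrow> b \<in> K \<Longrightarrow> f (a \<otimes> b) = f a * f b"
    using f by (auto simp: unitary_char_on_def)
  interpret K: subgroup K G by (rule K)
  have f1: "f \<one> = 1"
    using mult[of \<one> \<one>] norm[of \<one>] by auto
  have z1: "cmod z = 1"
    using norm[OF m(2)] m(1) power_eq_imp_eq_base[of "cmod z" m 1]
    unfolding z[symmetric] norm_power by simp
  have pow: "f (x [^] j) = z ^ j" if j: "x [^] j \<in> K" for j :: nat
  proof -
    define q r where "q = j div m" and "r = j mod m"
    have j_eq: "j = m * q + r"
      by (simp add: q_def r_def)
    have xq: "x [^] (m * q) = (x [^] m) [^] q"
      using x by (simp add: nat_pow_pow)
    have qK: "x [^] (m * q) \<in> K"
      unfolding xq using m(2) by (induction q) auto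
    have "x [^] j = x [^] (m * q) \<otimes> x [^] r"
      using x by (simp add: j_eq nat_pow_mult)
    then have "x [^] r = inv (x [^] (m * q)) \<otimes> x [^] j"
      using x by (simp add: m_assoc[symmetric])
    then have "x [^] r \<in> K"
      using qK j by simp
    moreover have "r < m"
      using m(1) by (simp add: r_def)
    ultimately have "r = 0"
      using m(3) by blast
    then show ?thesis
      using unitary_char_on_pow[OF f m(2), of q] z j_eq xq by (simp add: power_mult)
  qed
  define K' where "K' = {k \<otimes> x [^] i | k i. k \<in> K \<and> i \<in> (UNIV :: nat set)}"
  \<comment> \<open>The comparison assumes \<open>i \<le> i'\<close>, so that \<open>i' - i\<close>
    is a true difference of natural numbers; the other order follows by symmetry when
    \<open>f'\<close> is evaluated.\<close>
  have well: "f k * z ^ i = f k' * z ^ i'"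
    if eq: "k \<otimes> x [^] i = k' \<otimes> x [^] i'" "k \<in> K" "k' \<in> K" "i \<le> i'" for k k' and i i' :: nat
  proof -
    have "k' \<otimes> x [^] i' = (k' \<otimes> x [^] (i' - i)) \<otimes> x [^] i"
      using that x by (simp add: m_assoc nat_pow_mult)
    then have k: "k = k' \<otimes> x [^] (i' - i)"
      using that x by simp
    then have "x [^] (i' - i) = inv k' \<otimes> k"
      using that x by (simp add: m_assoc[symmetric])
    then have xK: "x [^] (i' - i) \<in> K"
      using that by simp
    have "f k * z ^ i = f k' * (z ^ (i' - i) * z ^ i)"
      using mult[OF that(3) xK] pow[OF xK] k by simp
    then show ?thesis
      using that(4) by (simp add: power_add[symmetric])
  qed
  define f' where "f' y = (SOME w. \<exists>k\<in>K. \<exists>i::nat. y = k \<otimes> x [^] i \<and> w = f k * z ^ i)" for y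
  have f': "f' (k \<otimes> x [^] i) = f k * z ^ i" if k: "k \<in> K" for k and i :: nat
  proof -
    have "\<exists>k'\<in>K. \<exists>i'::nat. k \<otimes> x [^] i = k' \<otimes> x [^] i' \<and> f' (k \<otimes> x [^] i) = f k' * z ^ i'"
      unfolding f'_def by (rule someI_ex) (use k in blast)
    then obtain k' and i' :: nat where
      k': "k' \<in> K" "k \<otimes> x [^] i = k' \<otimes> x [^] i'" "f' (k \<otimes> x [^] i) = f k' * z ^ i'"
      by blast
    then show ?thesis
      using well[OF k'(2) k k'(1)] well[OF k'(2)[symmetric] k'(1) k] by (metis nat_le_linear)
  qed
  have mulK': "k \<otimes> x [^] i \<otimes> (k' \<otimes> x [^] i') = (k \<otimes> k') \<otimes> x [^] (i + i')"
    if "k \<in> K" "k' \<in> K" for k k' and i i' :: nat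
    using that x by (simp add: nat_pow_mult[symmetric] m_ac)
  have "subgroup K' G"
  proof (rule subgroupI)
    show "K' \<subseteq> carrier G"
      using x by (auto simp: K'_def)
    show "K' \<noteq> {}"
      unfolding K'_def using K.one_closed by blast
  next
    fix a assume "a \<in> K'"
    then obtain k and i :: nat where a: "a = k \<otimes> x [^] i" "k \<in> K"
      by (auto simp: K'_def)
    \<comment> \<open>\<open>K'\<close> is built from natural exponents only;
      \<open>x [^] order G = \<one>\<close> turns the inverse of a power of \<open>x\<close> into
      another such power.\<close>
    have "x [^] i \<otimes> x [^] (i * (order G - 1)) = x [^] (order G * i)"
      using x order_pos by (cases "order G") (simp_all add: nat_pow_mult mult.commute)
    also have "\<dots> = \<one>"
      using x by (simp add: nat_pow_pow[symmetric] pow_order_eq_1)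
    finally have "inv (x [^] i) = x [^] (i * (order G - 1))"
      using x by (metis inv_equality m_comm nat_pow_closed)
    then have "inv a = inv k \<otimes> x [^] (i * (order G - 1))"
      using a x by (simp add: inv_mult)
    then show "inv a \<in> K'"
      using a by (auto simp: K'_def)
  next
    fix a b assume "a \<in> K'" "b \<in> K'"
    then show "a \<otimes> b \<in> K'"
      unfolding K'_def using mulK' by fastforce
  qed
  moreover have "f' (a \<otimes> b) = f' a * f' b" if ab: "a \<in> K'" "b \<in> K'" for a b
  proof -
    obtain k k' and i i' :: nat where
      *: "a = k \<otimes> x [^] i" "k \<in> K" "b = k' \<otimes> x [^] i'" "k' \<in> K"
      using ab by (auto simp: K'_def)
    then have "f' (a \<otimes> b) = f (k \<otimes> k') * z ^ (i + i')"
      using f'[of "k \<otimes> k'" "i + i'"] mulK' by simp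
    then show ?thesis
      using * f' mult by (simp add: power_add)
  qed
  moreover have "cmod (f' a) = 1" if "a \<in> K'" for a
    using that f' norm z1 by (auto simp: K'_def norm_mult norm_power)
  ultimately have "unitary_char_on G K' f'"
    by (auto simp: unitary_char_on_def)
  moreover have Kf: "a \<in> K' \<and> f' a = f a" if "a \<in> K" for a
  proof
    have a: "a = a \<otimes> x [^] (0::nat)"
      using that by simp
    then show "a \<in> K'"
      using that unfolding K'_def by blast
    show "f' a = f a"
      using f'[OF that, of 0] that by simp
  qed
  moreover have "x \<in> K' \<and> f' x = z"
  proof
    have a: "x = \<one> \<otimes> x [^] (1::nat)"
      using x by simp
    then show "x \<in> K'"
      using K.one_closed unfolding K'_def by blast
    show "f' x = z"
      using f'[OF K.one_closed, of 1] f1 x by simp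
  qed
  ultimately show ?thesis
    by blast
qed

lemma least_power_in_subgroup:
  assumes "subgroup K G" "x \<in> carrier G"
  obtains m :: nat where "m > 0" "x [^] m \<in> K" "\<And>i. 0 < i \<Longrightarrow> i < m \<Longrightarrow> x [^] i \<notin> K"
proof -
  define P where "P m \<longleftrightarrow> m > 0 \<and> x [^] m \<in> K" for m :: nat
  have "P (order G)"
    using assms order_pos pow_order_eq_1 subgroup.one_closed by (auto simp: P_def)
  then have "P (LEAST m. P m)"
    by (rule LeastI)
  then show ?thesis
    using that not_less_Least[of _ P] unfolding P_def by blast
qed

text \<open>Nonzero complex numbers have m-th roots for every m > 0, so a value for a missing
  element can always be chosen. Each adjunction shrinks the complement of \<open>K\<close>, which
  drives the induction.\<close>

lemma unitary_char_on_extend_carrier: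
  assumes "unitary_char_on G K f"
  shows "\<exists>f'. unitary_char_on G (carrier G) f' \<and> (\<forall>a\<in>K. f' a = f a)"
  using assms
proof (induction "card (carrier G - K)" arbitrary: K f rule: less_induct)
  case less
  have K: "subgroup K G"
    using less.prems by (simp add: unitary_char_on_def)
  show ?case
  proof (cases "K = carrier G")
    case True
    then show ?thesis using less.prems by blast
  next
    case False
    then obtain x where x: "x \<in> carrier G" "x \<notin> K"
      using subgroup.subset[OF K] by blast
    obtain m :: nat where m: "m > 0" "x [^] m \<in> K" "\<And>i. 0 < i \<Longrightarrow> i < m \<Longrightarrow> x [^] i \<notin> K"
      using least_power_in_subgroup[OF K x(1)] by metis
    have "f (x [^] m) \<noteq> 0"
      using less.prems m(2) by (force simp: unitary_char_on_def)
    then have "card {z. z ^ m = f (x [^] m)} = m"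
      using m(1) by (intro card_nth_roots) auto
    then obtain z where z: "z ^ m = f (x [^] m)"
      using m(1) by (metis (mono_tags, lifting) Collect_empty_eq card.empty less_irrefl)
    from unitary_char_on_extend[OF less.prems x(1) m z] obtain K' f' where
      *: "unitary_char_on G K' f'" "K \<subseteq> K'" "x \<in> K'" "\<forall>a\<in>K. f' a = f a" by blast
    have "card (carrier G - K') < card (carrier G - K)"
      using * x by (intro psubset_card_mono) auto
    from less.hyps[OF this *(1)] * show ?thesis
      by (metis subsetD)
  qed
qed

lemma dual_group_iff:
  "\<gamma> \<in> carrier (dual_group G) \<longleftrightarrow> unitary_char_on G (carrier G) \<gamma> \<and> \<gamma> \<in> extensional (carrier G)"
  by (auto simp: dual_group_def unitary_char_on_def hom_def circle_group_def subgroup_self)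

text \<open>Let m be the least positive exponent with \<open>g [^] m\<close> in \<open>H\<close>.
  Since \<open>g \<notin> H\<close>, m > 1, so there is an m-th root of unity other than 1. The
  trivial character of \<open>H\<close> can be given this value at \<open>g\<close> and then
  extended to all of \<open>G\<close>.\<close>

lemma ex_annihilator_neq_1:
  assumes H: "subgroup H G" and g: "g \<in> carrier G" "g \<notin> H"
  obtains \<gamma> where "\<gamma> \<in> annihilator G H" "\<gamma> g \<noteq> 1"
proof -
  have triv: "unitary_char_on G H (\<lambda>_. 1)"
    using H by (simp add: unitary_char_on_def)
  obtain m :: nat where m: "m > 0" "g [^] m \<in> H" "\<And>i. 0 < i \<Longrightarrow> i < m \<Longrightarrow> g [^] i \<notin> H"
    using least_power_in_subgroup[OF H g(1)] by metis
  have "m \<noteq> 1"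
    using m(2) g by auto
  then have "card {z::complex. z ^ m = 1} > 1"
    using m(1) card_roots_unity_eq[of m] by simp
  then have "\<not> {z::complex. z ^ m = 1} \<subseteq> {1}"
    by (metis card.empty card.insert_remove card_mono empty_Diff finite.emptyI finite.insertI
        not_less One_nat_def)
  then obtain z :: complex where z: "z ^ m = 1" "z \<noteq> 1"
    by auto
  from unitary_char_on_extend[OF triv g(1) m] z obtain K f where
    f: "unitary_char_on G K f" "H \<subseteq> K" "g \<in> K" "\<forall>a\<in>H. f a = 1" "f g = z" by blast
  from unitary_char_on_extend_carrier[OF f(1)] obtain f' where
    f': "unitary_char_on G (carrier G) f'" "\<forall>a\<in>K. f' a = f a" by blast
  have "restrict f' (carrier G) \<in> annihilator G H"
    using f f' subgroup.mem_carrier[OF H]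
    by (auto simp: annihilator_def dual_group_iff unitary_char_on_def)
  moreover have "restrict f' (carrier G) g \<noteq> 1"
    using f f' g z by auto
  ultimately show ?thesis
    using that by blast
qed

section \<open>Values of characters and finiteness of the dual group\<close>

lemma char_mult:
  "\<gamma> \<in> carrier (dual_group G) \<Longrightarrow> x \<in> carrier G \<Longrightarrow> y \<in> carrier G \<Longrightarrow> \<gamma> (x \<otimes> y) = \<gamma> x * \<gamma> y"
  by (simp add: dual_group_iff unitary_char_on_def)

lemma norm_char: "\<gamma> \<in> carrier (dual_group G) \<Longrightarrow> x \<in> carrier G \<Longrightarrow> cmod (\<gamma> x) = 1"
  by (simp add: dual_group_iff unitary_char_on_def)

lemma cnj_char_mult_self:
  "\<gamma> \<in> carrier (dual_group G) \<Longrightarrow> x \<in> carrier G \<Longrightarrow> cnj (\<gamma> x) * \<gamma> x = 1"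
  using norm_char[of \<gamma> x] complex_norm_square[of "\<gamma> x"] by (simp add: mult.commute)

lemma char_one: "\<gamma> \<in> carrier (dual_group G) \<Longrightarrow> \<gamma> \<one> = 1"
  using char_mult[of \<gamma> \<one> \<one>] norm_char[of \<gamma> \<one>] by auto

lemma char_inv:
  assumes "\<gamma> \<in> carrier (dual_group G)" "x \<in> carrier G"
  shows "\<gamma> (inv x) = cnj (\<gamma> x)"
proof -
  have "\<gamma> (inv x) * \<gamma> x = 1"
    using assms char_mult[of \<gamma> "inv x" x] char_one[of \<gamma>] by simp
  then show ?thesis
    using cnj_char_mult_self[OF assms] by (metis mult.commute mult.left_commute mult_1)
qed

lemma dual_group_inv_apply:
  assumes "\<gamma> \<in> carrier (dual_group G)" "x \<in> carrier G"
  shows "(inv\<^bsub>dual_group G\<^esub> \<gamma>) x = cnj (\<gamma> x)"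
proof -
  interpret X: comm_group "dual_group G"
    by (rule comm_group_dual_group) unfold_locales
  have "(inv\<^bsub>dual_group G\<^esub> \<gamma> \<otimes>\<^bsub>dual_group G\<^esub> \<gamma>) x = \<one>\<^bsub>dual_group G\<^esub> x"
    using assms by simp
  then have "(inv\<^bsub>dual_group G\<^esub> \<gamma>) x * \<gamma> x = 1"
    using assms by (simp only: dual_group_mult) (simp add: dual_group_def)
  then show ?thesis
    using cnj_char_mult_self[OF assms] by (metis mult.commute mult.left_commute mult_1)
qed

text \<open>Character values are roots of unity of exponent \<open>order G\<close>, and there are
  finitely many extensional functions into that finite set.\<close>

lemma finite_dual_group: "finite (carrier (dual_group G))"
proof (rule finite_subset)
  show "carrier (dual_group G) \<subseteq> carrier G \<rightarrow>\<^sub>E {z. z ^ order G = 1}"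
    using unitary_char_on_pow[of "carrier G" _ _ "order G"]
    by (auto simp: dual_group_iff PiE_def pow_order_eq_1 simp flip: char_one[unfolded dual_group_iff])
  show "finite (carrier G \<rightarrow>\<^sub>E {z::complex. z ^ order G = 1})"
    using order_pos by (intro finite_PiE) (auto intro!: finite_roots_unity)
qed

lemma finite_annihilator: "finite (annihilator G H)"
  by (rule finite_subset[OF _ finite_dual_group]) (auto simp: annihilator_def)

section \<open>Orthogonality relations and the order of the dual group\<close>

lemma sum_group_reindex:
  assumes "group X" "a \<in> carrier X"
  shows "(\<Sum>x\<in>carrier X. F (a \<otimes>\<^bsub>X\<^esub> x)) = (\<Sum>x\<in>carrier X. F x)"
proof -
  interpret X: group X by fact
  show ?thesis
    by (rule sum.reindex_bij_witness[where i = "\<lambda>x. inv\<^bsub>X\<^esub> a \<otimes>\<^bsub>X\<^esub> x" and j = "\<lambda>x. a \<otimes>\<^bsub>X\<^esub> x"])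
      (use assms(2) in \<open>auto simp: X.m_assoc[symmetric]\<close>)
qed

text \<open>Translation by \<open>k\<close> permutes the summands and multiplies the sum by
  \<open>\<gamma> k\<close>, a factor different from 1.\<close>

lemma sum_char_subgroup_eq_0:
  assumes "subgroup K G" "\<gamma> \<in> carrier (dual_group G)" "k \<in> K" "\<gamma> k \<noteq> 1"
  shows "(\<Sum>x\<in>K. \<gamma> x) = 0"
proof -
  have "(\<Sum>x\<in>K. \<gamma> x) = (\<Sum>x\<in>carrier (G\<lparr>carrier := K\<rparr>). \<gamma> (k \<otimes>\<^bsub>G\<lparr>carrier := K\<rparr>\<^esub> x))"
    by (subst sum_group_reindex) (use assms subgroup.subgroup_is_group is_group in auto)
  also have "\<dots> = \<gamma> k * (\<Sum>x\<in>K. \<gamma> x)"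
    using assms by (simp add: sum_distrib_left char_mult subgroup.mem_carrier)
  finally show ?thesis
    using assms(4) by auto
qed

text \<open>The dual translation argument: multiplying all characters by some
  \<open>\<delta>\<close> of the annihilator with \<open>\<delta> g \<noteq> 1\<close> rescales the
  sum. The extension of characters supplies this \<open>\<delta>\<close>.\<close>

lemma sum_annihilator_eq_0:
  assumes "subgroup H G" "g \<in> carrier G" "g \<notin> H"
  shows "(\<Sum>\<gamma>\<in>annihilator G H. \<gamma> g) = 0"
proof -
  obtain \<delta> where \<delta>: "\<delta> \<in> annihilator G H" "\<delta> g \<noteq> 1"
    using ex_annihilator_neq_1[OF assms] .
  let ?A = "(dual_group G)\<lparr>carrier := annihilator G H\<rparr>"
  have "subgroup (annihilator G H) (dual_group G)" "group (dual_group G)"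
    using subgroup_annihilator comm_group_dual_group assms(1) comm_group_axioms
    by (auto simp: comm_group_def)
  then have "group ?A"
    by (rule subgroup.subgroup_is_group)
  then have "(\<Sum>\<gamma>\<in>annihilator G H. \<gamma> g) = (\<Sum>\<gamma>\<in>carrier ?A. (\<delta> \<otimes>\<^bsub>?A\<^esub> \<gamma>) g)"
    by (subst sum_group_reindex) (use \<delta> in auto)
  also have "\<dots> = \<delta> g * (\<Sum>\<gamma>\<in>annihilator G H. \<gamma> g)"
    using assms by (simp add: sum_distrib_left dual_group_mult)
  finally show ?thesis
    using \<delta>(2) by auto
qed

lemma annihilator_dual: "\<gamma> \<in> annihilator G H \<Longrightarrow> \<gamma> \<in> carrier (dual_group G)"
  by (simp add: annihilator_def)

text \<open>Double counting of the values \<open>\<gamma> x\<close> over the annihilator and the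
  carrier. Summing over \<open>\<gamma>\<close> first leaves only \<open>x \<in> H\<close>; summing
  over \<open>x\<close> first leaves only the trivial character, with weight
  \<open>order G\<close>.\<close>

lemma card_annihilator:
  assumes "subgroup H G"
  shows "card (annihilator G H) * card H = order G"
proof -
  interpret X: comm_group "dual_group G"
    by (rule comm_group_dual_group) unfold_locales
  have one: "\<one>\<^bsub>dual_group G\<^esub> \<in> annihilator G H"
    using subgroup_annihilator[OF comm_group_axioms assms] by (rule subgroup.one_closed)
  have H: "H \<subseteq> carrier G"
    using assms by (rule subgroup.subset)
  have "(\<Sum>x\<in>carrier G. \<Sum>\<gamma>\<in>annihilator G H. \<gamma> x)
      = (\<Sum>x\<in>carrier G. if x \<in> H then of_nat (card (annihilator G H)) else 0)"
    using assms sum_annihilator_eq_0 by (intro sum.cong) (auto simp: annihilator_def)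
  also have "\<dots> = of_nat (card H * card (annihilator G H))"
    using H by (simp add: sum.If_cases Int_absorb1)
  finally have 1: "(\<Sum>x\<in>carrier G. \<Sum>\<gamma>\<in>annihilator G H. \<gamma> x)
      = of_nat (card H * card (annihilator G H))" .
  have "(\<Sum>\<gamma>\<in>annihilator G H. \<Sum>x\<in>carrier G. \<gamma> x)
      = (\<Sum>\<gamma>\<in>annihilator G H. if \<gamma> = \<one>\<^bsub>dual_group G\<^esub> then of_nat (order G) else 0)"
  proof (rule sum.cong[OF refl])
    fix \<gamma> assume \<gamma>: "\<gamma> \<in> annihilator G H"
    show "(\<Sum>x\<in>carrier G. \<gamma> x) = (if \<gamma> = \<one>\<^bsub>dual_group G\<^esub> then of_nat (order G) else 0)"
    proof (cases "\<exists>x\<in>carrier G. \<gamma> x \<noteq> 1")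
      case True
      then have "(\<Sum>x\<in>carrier G. \<gamma> x) = 0"
        using sum_char_subgroup_eq_0[OF subgroup_self annihilator_dual[OF \<gamma>]] by blast
      moreover have "\<gamma> \<noteq> \<one>\<^bsub>dual_group G\<^esub>"
        using True by (auto simp: dual_group_def)
      ultimately show ?thesis by simp
    next
      case False
      then have "\<gamma> = \<one>\<^bsub>dual_group G\<^esub>"
        using annihilator_dual[OF \<gamma>] by (auto simp: dual_group_def extensional_def fun_eq_iff)
      then show ?thesis
        by (simp add: dual_group_def order_def)
    qed
  qed
  also have "\<dots> = of_nat (order G)"
    using one finite_annihilator by (simp add: sum.delta)
  finally have "of_nat (card H * card (annihilator G H)) = (of_nat (order G) :: complex)"
    using 1 sum.swap[of "\<lambda>\<gamma> x. \<gamma> x" "carrier G" "annihilator G H"] by simp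
  then show ?thesis
    by (simp only: of_nat_eq_iff mult.commute)
qed

lemma sum_annihilator:
  assumes "subgroup H G" "g \<in> carrier G"
  shows "(\<Sum>\<gamma>\<in>annihilator G H. \<gamma> g) = (if g \<in> H then of_nat (card (annihilator G H)) else 0)"
  using sum_annihilator_eq_0[OF assms] by (simp add: annihilator_def)

text \<open>Specialising the annihilator facts to the trivial subgroup yields the order and the
  orthogonality relation of the full dual group.\<close>

lemma annihilator_trivial: "annihilator G {\<one>} = carrier (dual_group G)"
  by (auto simp: annihilator_def char_one)

lemma card_dual_group: "card (carrier (dual_group G)) = order G"
  using card_annihilator[OF triv_subgroup] by (simp add: annihilator_trivial)

lemma sum_dual_group:
  assumes "g \<in> carrier G"
  shows "(\<Sum>\<gamma>\<in>carrier (dual_group G). \<gamma> g) = (if g = \<one> then of_nat (order G) else 0)"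
  using sum_annihilator[OF triv_subgroup assms] by (simp add: annihilator_trivial card_dual_group)

end

section \<open>Difference counts\<close>

definition difference_count :: "('a, 'b) monoid_scheme \<Rightarrow> 'a set \<Rightarrow> 'a \<Rightarrow> nat" where
  "difference_count G A g = card {(d, d') \<in> A \<times> A. g = d \<otimes>\<^bsub>G\<^esub> inv\<^bsub>G\<^esub> d'}"

context finite_comm_group
begin

lemma finite_subgroup: "subgroup K G \<Longrightarrow> finite K"
  by (rule finite_subset[OF subgroup.subset finite_carrier])

text \<open>Inverses in the subgroup agree with those of \<open>G\<close>, so differences inside
  \<open>K\<close> may be counted in \<open>G\<close>, where the characters of \<open>G\<close>
  apply.\<close>

lemma difference_set_subgroup_iff:
  assumes "subgroup K G" "A \<subseteq> K"
  shows "difference_set (G\<lparr>carrier := K\<rparr>) A \<longleftrightarrow> (\<exists>l. \<forall>g\<in>K - {\<one>}. difference_count G A g = l)"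
proof -
  have "{(d, d') \<in> A \<times> A. g = d \<otimes>\<^bsub>G\<lparr>carrier := K\<rparr>\<^esub> inv\<^bsub>G\<lparr>carrier := K\<rparr>\<^esub> d'} =
        {(d, d') \<in> A \<times> A. g = d \<otimes> inv d'}" for g
    using assms m_inv_consistent[OF assms(1)] by auto
  then show ?thesis
    using assms(2) by (simp add: difference_set_def difference_count_def)
qed

lemma mult_inv_eq_one_iff:
  assumes "x \<in> carrier G" "y \<in> carrier G"
  shows "x \<otimes> inv y = \<one> \<longleftrightarrow> x = y"
  using inv_solve_right[OF one_closed assms] assms(2) by auto

lemma difference_count_one:
  assumes "A \<subseteq> carrier G"
  shows "difference_count G A \<one> = card A"
proof -
  have "{(d, d') \<in> A \<times> A. \<one> = d \<otimes> inv d'} = (\<lambda>d. (d, d)) ` A"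
    using assms by (auto simp: subset_iff mult_inv_eq_one_iff eq_commute[of \<one>])
  then show ?thesis
    by (simp add: difference_count_def card_image inj_on_def)
qed

text \<open>The common source of the counting identities: \<open>F = 1\<close> counts pairs, the
  indicator of \<open>H\<close> counts pairs in a common coset, and a character gives the squared
  modulus of its sum over \<open>A\<close>. Some of these are real and some complex, hence the
  general semiring.\<close>

lemma sum_differences:
  fixes F :: "'a \<Rightarrow> 'c :: comm_semiring_1"
  assumes K: "subgroup K G" and A: "A \<subseteq> K"
  shows "(\<Sum>d\<in>A. \<Sum>d'\<in>A. F (d \<otimes> inv d')) = (\<Sum>g\<in>K. of_nat (difference_count G A g) * F g)"
proof -
  let ?q = "\<lambda>p. fst p \<otimes> inv (snd p)"
  have fin: "finite A" "finite K"
    using finite_subgroup[OF K] A finite_subset by auto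
  have "(\<Sum>d\<in>A. \<Sum>d'\<in>A. F (d \<otimes> inv d')) = (\<Sum>p\<in>A \<times> A. F (?q p))"
    by (simp add: sum.cartesian_product case_prod_beta)
  also have "\<dots> = (\<Sum>g\<in>K. \<Sum>p | p \<in> A \<times> A \<and> ?q p = g. F (?q p))"
    using fin A subgroup.m_closed[OF K] subgroup.m_inv_closed[OF K]
    by (intro sum.group[symmetric]) (auto simp: subset_iff)
  also have "\<dots> = (\<Sum>g\<in>K. of_nat (difference_count G A g) * F g)"
  proof (rule sum.cong[OF refl])
    fix g
    have eq: "{p. p \<in> A \<times> A \<and> ?q p = g} = {(d, d') \<in> A \<times> A. g = d \<otimes> inv d'}"
      by auto
    have "(\<Sum>p | p \<in> A \<times> A \<and> ?q p = g. F (?q p)) = (\<Sum>p | p \<in> A \<times> A \<and> ?q p = g. F g)"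
      by (rule sum.cong) auto
    then show "(\<Sum>p | p \<in> A \<times> A \<and> ?q p = g. F (?q p)) = of_nat (difference_count G A g) * F g"
      unfolding eq by (simp add: difference_count_def)
  qed
  finally show ?thesis .
qed

lemma sum_differences_difference_set:
  fixes F :: "'a \<Rightarrow> 'c :: comm_semiring_1"
  assumes K: "subgroup K G" and A: "A \<subseteq> K"
    and l: "\<And>g. g \<in> K \<Longrightarrow> g \<noteq> \<one> \<Longrightarrow> difference_count G A g = l"
  shows "(\<Sum>d\<in>A. \<Sum>d'\<in>A. F (d \<otimes> inv d')) =
    of_nat (card A) * F \<one> + of_nat l * (\<Sum>g\<in>K - {\<one>}. F g)"
proof -
  have "A \<subseteq> carrier G"
    using A subgroup.subset[OF K] by blast
  then show ?thesis
    using sum_differences[OF K A, of F] l finite_subgroup[OF K] subgroup.one_closed[OF K]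
    by (simp add: sum.remove[of K \<one>] difference_count_one sum_distrib_left)
qed

lemma difference_set_card:
  assumes K: "subgroup K G" and A: "A \<subseteq> K"
    and l: "\<And>g. g \<in> K \<Longrightarrow> g \<noteq> \<one> \<Longrightarrow> difference_count G A g = l"
  shows "(real (card A))\<^sup>2 = real (card A) + real l * (real (card K) - 1)"
proof -
  have "real (card (K - {\<one>})) = real (card K) - 1"
    using finite_subgroup[OF K] subgroup.one_closed[OF K]
    by (metis card_gt_0_iff card_Diff_singleton empty_iff of_nat_1 of_nat_diff Suc_leI One_nat_def)
  then show ?thesis
    using sum_differences_difference_set[OF assms, where F = "\<lambda>_. 1 :: real"]
    by (simp add: power2_eq_square)
qed

lemma norm_sum_char_squared:
  assumes "A \<subseteq> carrier G" "\<gamma> \<in> carrier (dual_group G)"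
  shows "complex_of_real ((cmod (\<Sum>d\<in>A. \<gamma> d))\<^sup>2) = (\<Sum>d\<in>A. \<Sum>d'\<in>A. \<gamma> (d \<otimes> inv d'))"
proof -
  have "complex_of_real ((cmod (\<Sum>d\<in>A. \<gamma> d))\<^sup>2) = (\<Sum>d\<in>A. \<Sum>d'\<in>A. \<gamma> d * cnj (\<gamma> d'))"
    by (simp only: complex_norm_square sum_product cnj_sum)
  also have "\<dots> = (\<Sum>d\<in>A. \<Sum>d'\<in>A. \<gamma> (d \<otimes> inv d'))"
    using assms by (intro sum.cong) (auto simp: char_mult char_inv subset_iff)
  finally show ?thesis .
qed

text \<open>A character nontrivial on \<open>K\<close> sums to 0 over \<open>K\<close>, hence to -1
  over the nonidentity elements; the off-diagonal pairs thus contribute \<open>- l\<close>.\<close>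

lemma norm_sum_char_difference_set:
  assumes K: "subgroup K G" and A: "A \<subseteq> K"
    and l: "\<And>g. g \<in> K \<Longrightarrow> g \<noteq> \<one> \<Longrightarrow> difference_count G A g = l"
    and \<gamma>: "\<gamma> \<in> carrier (dual_group G)" "\<gamma> \<notin> annihilator G K"
  shows "(cmod (\<Sum>d\<in>A. \<gamma> d))\<^sup>2 = real (card A) - real l"
proof -
  obtain k where "k \<in> K" "\<gamma> k \<noteq> 1"
    using \<gamma> by (auto simp: annihilator_def)
  then have "(\<Sum>g\<in>K. \<gamma> g) = 0"
    using sum_char_subgroup_eq_0[OF K \<gamma>(1)] by blast
  then have "(\<Sum>g\<in>K - {\<one>}. \<gamma> g) = -1"
    using \<gamma>(1) finite_subgroup[OF K] subgroup.one_closed[OF K]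
    by (simp add: sum_diff1 char_one)
  moreover have "A \<subseteq> carrier G"
    using A subgroup.subset[OF K] by blast
  ultimately have "complex_of_real ((cmod (\<Sum>d\<in>A. \<gamma> d))\<^sup>2) = of_nat (card A) - of_nat l"
    using norm_sum_char_squared[OF _ \<gamma>(1)] sum_differences_difference_set[OF assms(1-3), of \<gamma>] \<gamma>(1)
    by (simp add: char_one)
  then have "complex_of_real ((cmod (\<Sum>d\<in>A. \<gamma> d))\<^sup>2) = complex_of_real (real (card A) - real l)"
    by simp
  then show ?thesis
    unfolding of_real_eq_iff .
qed

text \<open>The difference counts are the autocorrelation of the indicator of \<open>A\<close>,
  whose Fourier transform is the squared modulus of the character sums; orthogonality over the dual
  group inverts it.\<close>

lemma difference_count_fourier:
  assumes A: "A \<subseteq> carrier G" and g: "g \<in> carrier G"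
  shows "of_nat (order G) * of_nat (difference_count G A g) =
    (\<Sum>\<gamma>\<in>carrier (dual_group G). cnj (\<gamma> g) * complex_of_real ((cmod (\<Sum>d\<in>A. \<gamma> d))\<^sup>2))"
proof -
  have "(\<Sum>\<gamma>\<in>carrier (dual_group G). cnj (\<gamma> g) * complex_of_real ((cmod (\<Sum>d\<in>A. \<gamma> d))\<^sup>2)) =
    (\<Sum>\<gamma>\<in>carrier (dual_group G). \<Sum>x\<in>carrier G. of_nat (difference_count G A x) * \<gamma> (x \<otimes> inv g))"
    using g by (intro sum.cong refl, subst norm_sum_char_squared[OF A])
      (simp_all add: sum_differences[OF subgroup_self A] sum_distrib_left char_mult char_inv mult_ac)
  also have "\<dots> = (\<Sum>x\<in>carrier G. of_nat (difference_count G A x) *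
      (\<Sum>\<gamma>\<in>carrier (dual_group G). \<gamma> (x \<otimes> inv g)))"
    by (subst sum.swap) (simp add: sum_distrib_left)
  also have "\<dots> = (\<Sum>x\<in>carrier G. if x = g then of_nat (order G) * of_nat (difference_count G A g) else 0)"
  proof (intro sum.cong refl)
    fix x assume x: "x \<in> carrier G"
    have "x \<otimes> inv g = \<one> \<longleftrightarrow> x = g"
      using x g by (rule mult_inv_eq_one_iff)
    then show "of_nat (difference_count G A x) * (\<Sum>\<gamma>\<in>carrier (dual_group G). \<gamma> (x \<otimes> inv g)) =
      (if x = g then of_nat (order G) * of_nat (difference_count G A g) else 0)"
      using x g by (simp add: sum_dual_group)
  qed
  also have "\<dots> = of_nat (order G) * of_nat (difference_count G A g)"
    using g by simp
  finally show ?thesis ..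
qed

end

section \<open>Fine difference sets\<close>

locale fine_difference_set_setting = finite_comm_group G for G (structure) +
  fixes H D :: "'a set"
  assumes subgroup_H: "subgroup H G" and fine: "fine_difference_set G H D"
begin

abbreviation fiber :: "'a \<Rightarrow> 'a set" where
  "fiber g \<equiv> {d. d \<in> D \<and> H #> d = H #> g}"

text \<open>The natural number behind \<open>fine_S G D\<close>: the number of nonzero cosets, which
  is S because fineness prescribes |H| = |G| / (S + 1). Divisibility and the algebra are carried out
  with \<open>s\<close>.\<close>

definition s :: nat where
  "s = card (rcosets H) - 1"

lemma D_subset: "D \<subseteq> carrier G" and D_nonempty: "D \<noteq> {}" and D_H: "D \<inter> H = {}"
  using fine by (auto simp: fine_difference_set_def difference_set_def)

lemma D_carrier [simp]: "d \<in> D \<Longrightarrow> d \<in> carrier G"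
  using D_subset by blast

lemma finite_D [simp]: "finite D"
  using finite_subset[OF D_subset finite_carrier] .

lemma finite_H [simp]: "finite H"
  using finite_subgroup[OF subgroup_H] .

lemma H_carrier [simp]: "h \<in> H \<Longrightarrow> h \<in> carrier G"
  using subgroup.mem_carrier[OF subgroup_H] .

lemma card_D_pos: "card D > 0"
  using D_nonempty by (simp add: card_gt_0_iff)

lemma card_H_pos: "card H > 0"
  using subgroup.one_closed[OF subgroup_H] by (auto simp: card_gt_0_iff)

lemma order_eq: "(s + 1) * card H = order G"
proof -
  have "card (rcosets H) * card H = order G"
    using lagrange[OF subgroup_H] .
  moreover from this have "card (rcosets H) > 0"
    using order_pos by (metis gr0I mult_0 less_irrefl)
  ultimately show ?thesis
    by (simp add: s_def)
qed

lemma fine_S_eq: "fine_S G D = real s"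
proof -
  have H: "real (card H) = real (order G) / (fine_S G D + 1)"
    using fine by (simp add: fine_difference_set_def)
  \<comment> \<open>Division by 0 gives 0, so \<open>fine_S G D + 1 = 0\<close> would force
    \<open>card H = 0\<close>.\<close>
  then have "fine_S G D + 1 \<noteq> 0"
    using card_H_pos by auto
  then have "real (card H) * (fine_S G D + 1) = real (card H) * (real s + 1)"
    using H order_eq by (simp add: field_simps flip: of_nat_mult of_nat_Suc)
  then show ?thesis
    using card_H_pos by (simp only: mult_cancel_left) auto
qed

lemma card_D_less: "card D < order G"
  unfolding order_def
  using D_subset D_H subgroup.one_closed[OF subgroup_H]
  by (intro psubset_card_mono) auto

lemma s_squared: "(real s)\<^sup>2 * (real (order G) - real (card D)) = real (card D) * (real (order G) - 1)"
proof -
  have "real (order G) - 1 \<ge> 0"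
    using order_pos by simp
  then have "(real s)\<^sup>2 = real (card D) * (real (order G) - 1) / (real (order G) - real (card D))"
    using card_D_less unfolding fine_S_eq[symmetric] fine_S_def by simp
  then show ?thesis
    using card_D_less by simp
qed

lemma s_pos: "s > 0"
proof (rule ccontr)
  assume "\<not> s > 0"
  then have "real (card D) * (real (order G) - 1) = 0"
    using s_squared by simp
  then show False
    using card_D_pos card_D_less by simp
qed

text \<open>The defining equation of S with |G| = (S + 1) |H| inserted; the factor S + 1 cancels
  because S^2 - 1 = (S - 1) (S + 1).\<close>

lemma card_H_identity: "real (card H) * ((real s)\<^sup>2 - real (card D)) = real (card D) * (real s - 1)"
proof -
  have G: "real (order G) = (real s + 1) * real (card H)"
    by (simp only: order_eq[symmetric] of_nat_mult of_nat_add of_nat_1)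
  have "(real s + 1) * (real (card H) * ((real s)\<^sup>2 - real (card D))) =
        (real s + 1) * (real (card D) * (real s - 1))"
    using s_squared unfolding G by (simp add: algebra_simps power2_eq_square)
  then show ?thesis
    by (simp only: mult_cancel_left) auto
qed

section \<open>First and second moments of the coset intersections\<close>

lemma sum_of_bool_coset:
  assumes d: "d \<in> carrier G"
  shows "(\<Sum>g\<in>carrier G. of_bool (H #> d = H #> g)) = real (card H)"
proof -
  have "(\<Sum>g\<in>carrier G. of_bool (H #> d = H #> g)) = real (card {g \<in> carrier G. H #> d = H #> g})"
    by (simp add: sum.If_cases of_bool_def Int_def)
  also have "{g \<in> carrier G. H #> d = H #> g} = H #> d"
    using d subgroup_H repr_independence[of _ H d] repr_independenceD[of H _ d]
      subgroup.elemrcos_carrier[OF subgroup_H is_group] by blast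
  also have "card (H #> d) = card H"
    using card_rcosets_equal[OF rcosetsI[OF subgroup.subset[OF subgroup_H] d]]
      subgroup.subset[OF subgroup_H] by simp
  finally show ?thesis .
qed

lemma card_fiber_eq_sum: "real (card (fiber g)) = (\<Sum>d\<in>D. of_bool (H #> d = H #> g))"
  by (simp add: of_bool_def sum.If_cases Int_def)

lemma fiber_subgroup:
  assumes "g \<in> H"
  shows "fiber g = {}"
proof -
  have "H #> g = H"
    using assms subgroup.rcos_const[OF subgroup_H is_group] by simp
  then show ?thesis
    using D_H rcos_self[OF _ subgroup_H] by auto
qed

lemma sum_card_fiber: "(\<Sum>g\<in>carrier G. real (card (fiber g))) = real (card H) * real (card D)"
  by (simp only: card_fiber_eq_sum, subst sum.swap)
    (simp only: sum_of_bool_coset D_carrier sum_constant mult.commute cong: sum.cong)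

lemma difference_count_D:
  obtains l where "\<And>g. g \<in> carrier G \<Longrightarrow> g \<noteq> \<one> \<Longrightarrow> difference_count G D g = l"
  using fine by (auto simp: fine_difference_set_def difference_set_def difference_count_def)

text \<open>The sum runs over representatives, so each coset counts |H| times. The squares count
  pairs of elements of \<open>D\<close> in a common coset, that is, with difference in
  \<open>H\<close>; the difference set property evaluates this number as D + \<lambda> (|H| -
  1).\<close>

lemma sum_card_fiber_squared:
  "(\<Sum>g\<in>carrier G. (real (card (fiber g)))\<^sup>2) = real (card H) * ((real (card D))\<^sup>2 / real s)"
proof -
  obtain l where l: "\<And>g. g \<in> carrier G \<Longrightarrow> g \<noteq> \<one> \<Longrightarrow> difference_count G D g = l"
    using difference_count_D by blast
  have "(\<Sum>g\<in>carrier G. (real (card (fiber g)))\<^sup>2) =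
    (\<Sum>g\<in>carrier G. \<Sum>d\<in>D. \<Sum>d'\<in>D. of_bool (H #> d = H #> g) * of_bool (H #> d' = H #> g))"
    by (simp only: card_fiber_eq_sum power2_eq_square sum_product)
  also have "\<dots> = (\<Sum>d\<in>D. \<Sum>d'\<in>D. \<Sum>g\<in>carrier G. of_bool (H #> d = H #> g) * of_bool (H #> d' = H #> g))"
    by (subst sum.swap, rule sum.cong[OF refl], rule sum.swap)
  also have "\<dots> = (\<Sum>d\<in>D. \<Sum>d'\<in>D. real (card H) * of_bool (d \<otimes> inv d' \<in> H))"
  proof (intro sum.cong refl)
    fix d d' assume d: "d \<in> D" "d' \<in> D"
    have "(\<Sum>g\<in>carrier G. of_bool (H #> d = H #> g) * of_bool (H #> d' = H #> g)) =
      (\<Sum>g\<in>carrier G. of_bool (H #> d = H #> g) * of_bool (H #> d = H #> d') :: real)"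
      by (rule sum.cong) auto
    then show "(\<Sum>g\<in>carrier G. of_bool (H #> d = H #> g) * of_bool (H #> d' = H #> g)) =
      real (card H) * of_bool (d \<otimes> inv d' \<in> H)"
      using d by (simp only: sum_distrib_right[symmetric] sum_of_bool_coset D_carrier
          rcos_eq_iff[OF subgroup_H])
  qed
  also have "\<dots> = real (card H) * (\<Sum>d\<in>D. \<Sum>d'\<in>D. of_bool (d \<otimes> inv d' \<in> H))"
    by (simp only: sum_distrib_left)
  also have "(\<Sum>d\<in>D. \<Sum>d'\<in>D. of_bool (d \<otimes> inv d' \<in> H)) =
    real (card D) + real l * (\<Sum>g\<in>carrier G - {\<one>}. of_bool (g \<in> H))"
    using sum_differences_difference_set[OF subgroup_self D_subset l, where F = "\<lambda>g. of_bool (g \<in> H)"]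
      subgroup.one_closed[OF subgroup_H] by simp
  also have "(\<Sum>g\<in>carrier G - {\<one>}. of_bool (g \<in> H)) = real (card H) - 1"
  proof -
    have "(\<Sum>g\<in>carrier G - {\<one>}. of_bool (g \<in> H)) = (\<Sum>g\<in>H - {\<one>}. 1 :: real)"
      using subgroup.subset[OF subgroup_H] by (intro sum.mono_neutral_cong_right) auto
    then show ?thesis
      using subgroup.one_closed[OF subgroup_H] card_H_pos by (simp add: of_nat_diff)
  qed
  also have "real (card D) + real l * (real (card H) - 1) = (real (card D))\<^sup>2 / real s"
  proof -
    have G: "real (order G) = (real s + 1) * real (card H)"
      by (simp only: order_eq[symmetric] of_nat_mult of_nat_add of_nat_1)
    have l_eq: "(real (card D))\<^sup>2 = real (card D) + real l * (real (order G) - 1)"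
      using difference_set_card[OF subgroup_self D_subset l] by (simp add: order_def)
    have G1: "real (order G) - 1 > 0"
      using card_D_pos card_D_less by simp
    \<comment> \<open>Multiplication by |G| - 1 lets \<open>l_eq\<close> eliminate \<open>l\<close>;
      the result differs from (|G| - 1) D^2 only by a multiple of
      \<open>card_H_identity\<close>.\<close>
    have "(real (order G) - 1) * (real s * (real (card D) + real l * (real (card H) - 1))) =
      real s * (real (card D) * (real (order G) - 1) + (real l * (real (order G) - 1)) * (real (card H) - 1))"
      by (simp add: algebra_simps)
    also have "real l * (real (order G) - 1) = (real (card D))\<^sup>2 - real (card D)"
      using l_eq by simp
    also have "real s * (real (card D) * (real (order G) - 1) +
        ((real (card D))\<^sup>2 - real (card D)) * (real (card H) - 1)) =
        (real (order G) - 1) * (real (card D))\<^sup>2 + real (card D) *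
        (real (card H) * ((real s)\<^sup>2 - real (card D)) - real (card D) * (real s - 1))"
      unfolding G by (simp add: algebra_simps power2_eq_square)
    also have "\<dots> = (real (order G) - 1) * (real (card D))\<^sup>2"
      by (simp add: card_H_identity)
    finally have "real s * (real (card D) + real l * (real (card H) - 1)) = (real (card D))\<^sup>2"
      using G1 by (simp only: mult_cancel_left) auto
    then show ?thesis
      using s_pos by (simp add: eq_divide_eq mult.commute)
  qed
  finally show ?thesis .
qed

text \<open>The variance of the coset intersections over the nonzero cosets vanishes.\<close>

lemma card_fiber:
  assumes "g \<in> carrier G" "g \<notin> H"
  shows "real s * real (card (fiber g)) = real (card D)"
proof -
  \<comment> \<open>The mean of the fiber sizes over the \<open>s\<close> nonzero cosets, since
    \<open>D\<close> misses \<open>H\<close>. A vanishing sum of squared deviations makes every size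
    equal to it.\<close>
  define k where "k = real (card D) / real s"
  have "(\<Sum>g\<in>carrier G - H. (real (card (fiber g)) - k)\<^sup>2) =
      (\<Sum>g\<in>carrier G. (real (card (fiber g)) - k)\<^sup>2) - (\<Sum>g\<in>H. (real (card (fiber g)) - k)\<^sup>2)"
    using subgroup.subset[OF subgroup_H] by (simp add: sum_diff)
  also have "(\<Sum>g\<in>H. (real (card (fiber g)) - k)\<^sup>2) = (\<Sum>g\<in>H. k\<^sup>2)"
    by (rule sum.cong[OF refl]) (simp add: fiber_subgroup)
  also have "(\<Sum>g\<in>carrier G. (real (card (fiber g)) - k)\<^sup>2) =
      (\<Sum>g\<in>carrier G. (real (card (fiber g)))\<^sup>2 - 2 * k * real (card (fiber g)) + k\<^sup>2)"
    by (rule sum.cong[OF refl]) (simp add: power2_diff)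
  also have "\<dots> = real (card H) * ((real (card D))\<^sup>2 / real s) - 2 * k * (real (card H) * real (card D))
      + real (order G) * k\<^sup>2"
    by (simp only: sum.distrib sum_subtractf sum_distrib_left[symmetric] sum_card_fiber_squared
        sum_card_fiber sum_constant order_def)
  also have "\<dots> - (\<Sum>g\<in>H. k\<^sup>2) = 0"
    using s_pos order_eq[symmetric] by (simp add: k_def field_simps power2_eq_square)
  finally have "(real (card (fiber g)) - k)\<^sup>2 = 0"
    using assms by (subst (asm) sum_nonneg_eq_0_iff) auto
  then show ?thesis
    using s_pos by (simp add: k_def field_simps)
qed

lemma card_D_eq:
  assumes "g \<in> carrier G" "g \<notin> H"
  shows "card D = s * card (fiber g)"
  using card_fiber[OF assms] by (simp flip: of_nat_mult)

section \<open>Fibers of \<open>D\<close> as translates of the sets \<open>D_g\<close>\<close>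

lemma shifted_part_alt:
  assumes "g \<in> carrier G"
  shows "shifted_part G H D g = {h \<in> H. h \<otimes> g \<in> D}"
proof -
  have "h \<in> D #> inv g \<longleftrightarrow> h \<otimes> g \<in> D" if "h \<in> carrier G" for h
  proof
    assume "h \<in> D #> inv g"
    then show "h \<otimes> g \<in> D"
      using assms by (auto simp: r_coset_def m_assoc)
  next
    assume "h \<otimes> g \<in> D"
    moreover have "h = h \<otimes> g \<otimes> inv g"
      using assms that by (simp add: m_assoc)
    ultimately show "h \<in> D #> inv g"
      by (auto simp: r_coset_def)
  qed
  then show ?thesis
    by (auto simp: shifted_part_def)
qed

lemma bij_betw_fiber:
  assumes g: "g \<in> carrier G"
  shows "bij_betw (\<lambda>h. h \<otimes> g) (shifted_part G H D g) (fiber g)"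
proof (rule bij_betw_byWitness[where f' = "\<lambda>d. d \<otimes> inv g"])
  have "H #> (h \<otimes> g) = H #> g" if "h \<in> H" for h
    using that g by (simp add: rcos_eq_iff[OF subgroup_H] m_assoc)
  then show "(\<lambda>h. h \<otimes> g) ` shifted_part G H D g \<subseteq> fiber g"
    using g by (auto simp: shifted_part_alt)
  show "(\<lambda>d. d \<otimes> inv g) ` fiber g \<subseteq> shifted_part G H D g"
    using g by (auto simp: shifted_part_alt rcos_eq_iff[OF subgroup_H] m_assoc)
qed (use g in \<open>auto simp: shifted_part_alt m_assoc\<close>)

lemma card_shifted_part:
  assumes "g \<in> carrier G"
  shows "card (shifted_part G H D g) = card (fiber g)"
  using bij_betw_same_card[OF bij_betw_fiber[OF assms]] .

text \<open>Gram entries involve sums over fibers of \<open>D\<close>, whereas the difference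
  property concerns \<open>D_g\<close>. Translation by \<open>g\<close> relates them at the cost of
  a factor \<open>\<gamma> g\<close> of modulus 1.\<close>

lemma sum_fiber:
  assumes g: "g \<in> carrier G" and \<gamma>: "\<gamma> \<in> carrier (dual_group G)"
  shows "(\<Sum>d\<in>fiber g. \<gamma> d) = (\<Sum>h\<in>shifted_part G H D g. \<gamma> h) * \<gamma> g"
  using sum.reindex_bij_betw[OF bij_betw_fiber[OF g], of \<gamma>] assms
  by (simp add: shifted_part_alt char_mult sum_distrib_right)

lemma shifted_part_subset: "shifted_part G H D g \<subseteq> H"
  by (simp add: shifted_part_def)

lemma shifted_part_difference_set_iff:
  "difference_set (G\<lparr>carrier := H\<rparr>) (shifted_part G H D g) \<longleftrightarrow>
     (\<exists>l. \<forall>h\<in>H - {\<one>}. difference_count G (shifted_part G H D g) h = l)"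
  by (rule difference_set_subgroup_iff[OF subgroup_H shifted_part_subset])

text \<open>Write k for the fiber size. Counting pairs in \<open>D_g\<close> gives k^2 = k + l (|H|
  - 1), and \<open>card_H_identity\<close> with D = S k gives S (|H| - k) = k (|H| - 1). Eliminating
  \<open>l\<close> leaves the factor |H| - 1 on both sides, which is nonzero for nontrivial
  \<open>H\<close>.\<close>

lemma shifted_part_index:
  assumes g: "g \<in> carrier G" "g \<notin> H" and H: "H \<noteq> {\<one>}"
    and l: "\<And>h. h \<in> H \<Longrightarrow> h \<noteq> \<one> \<Longrightarrow> difference_count G (shifted_part G H D g) h = l"
  shows "real s * (real (card (fiber g)) - real l) = (real (card (fiber g)))\<^sup>2"
proof -
  define k where "k = real (card (fiber g))"
  have k: "k\<^sup>2 = k + real l * (real (card H) - 1)"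
    using difference_set_card[OF subgroup_H shifted_part_subset l] g
    by (simp add: k_def card_shifted_part)
  have D: "real (card D) = real s * k"
    using card_fiber[OF g] by (simp add: k_def)
  then have "real s * (real (card H) * (real s - k)) = real s * (k * (real s - 1))"
    using card_H_identity unfolding D by (simp add: algebra_simps power2_eq_square)
  then have "real (card H) * (real s - k) = k * (real s - 1)"
    using s_pos by simp
  then have *: "real s * (real (card H) - k) = k * (real (card H) - 1)"
    by (simp add: algebra_simps)
  have "(real (card H) - 1) * (real s * (k - real l)) =
      real s * k * (real (card H) - 1) - real s * (real l * (real (card H) - 1))"
    by (simp add: algebra_simps)
  also have "real l * (real (card H) - 1) = k\<^sup>2 - k"
    using k by simp
  also have "real s * k * (real (card H) - 1) - real s * (k\<^sup>2 - k) = k * (real s * (real (card H) - k))"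
    by (simp add: algebra_simps power2_eq_square)
  also have "\<dots> = (real (card H) - 1) * k\<^sup>2"
    unfolding * by (simp add: power2_eq_square)
  finally have "(real (card H) - 1) * (real s * (k - real l)) = (real (card H) - 1) * k\<^sup>2" .
  moreover have "card H \<noteq> 1"
    using H subgroup.one_closed[OF subgroup_H] by (auto simp: card_1_singleton_iff)
  ultimately show ?thesis
    by (simp add: k_def)
qed

end

section \<open>Column spaces and orthogonal projections\<close>

lemma sum_fun_apply: "(\<Sum>a\<in>A. f a) x = (\<Sum>a\<in>A. f a x)" for f :: "'c \<Rightarrow> 'i \<Rightarrow> 'b::comm_monoid_add"
  by (induction A rule: infinite_finite_induct) auto

text \<open>The value 0 off \<open>I\<close> places every image in \<open>cspace I\<close>, so
  identities between matrix actions become plain equalities of functions.\<close>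

definition mat_vec :: "'i set \<Rightarrow> 'j set \<Rightarrow> ('i \<Rightarrow> 'j \<Rightarrow> complex) \<Rightarrow> ('j \<Rightarrow> complex) \<Rightarrow> 'i \<Rightarrow> complex" where
  "mat_vec I J A v = (\<lambda>i. if i \<in> I then \<Sum>j\<in>J. A i j * v j else 0)"

lemma mat_vec_cspace: "mat_vec I J A v \<in> cspace I"
  by (simp add: mat_vec_def cspace_def)

lemma mat_vec_mat_vec: "mat_vec I J A (mat_vec J K B v) = mat_vec I K (mat_times J A B) v"
proof
  fix i
  show "mat_vec I J A (mat_vec J K B v) i = mat_vec I K (mat_times J A B) v i"
    using sum.swap[of "\<lambda>k j. A i j * (B j k * v k)" J K]
    by (simp add: mat_vec_def mat_times_def sum_distrib_left sum_distrib_right mult.assoc)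
qed

lemma mat_vec_cong: "mat_eq I J A B \<Longrightarrow> mat_vec I J A v = mat_vec I J B v"
  by (auto simp: mat_vec_def mat_eq_def intro!: sum.cong)

lemma mat_vec_cscale: "mat_vec I J A (cscale c v) = cscale c (mat_vec I J A v)"
  by (auto simp: mat_vec_def cscale_def sum_distrib_left algebra_simps)

lemma mat_vec_diagonal:
  assumes "finite J" "diagonal_on J A"
  shows "mat_vec J J A v = (\<lambda>j. if j \<in> J then A j j * v j else 0)"
proof
  fix j
  have "(\<Sum>k\<in>J. A j k * v k) = (\<Sum>k\<in>J. if k = j then A j j * v j else 0)" if "j \<in> J"
    using assms(2) that by (intro sum.cong) (auto simp: diagonal_on_def)
  then show "mat_vec J J A v j = (if j \<in> J then A j j * v j else 0)"
    using assms(1) by (simp add: mat_vec_def)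
qed

text \<open>Describing the span as the image of a linear map reduces inclusions and projections to
  matrix identities.\<close>

lemma column_space_eq_range:
  assumes "finite J"
  shows "column_space I J A = range (mat_vec I J A)"
proof
  have col: "mat_vec I J A w = (\<Sum>j\<in>J. cscale (w j) (\<lambda>i. if i \<in> I then A i j else 0))" for w
    by (auto simp: mat_vec_def cscale_def sum_fun_apply fun_eq_iff mult.commute)
  have "mat_vec I J A w \<in> column_space I J A" for w
    unfolding column_space_def col
    by (intro cfun.span_sum cfun.span_scale cfun.span_base imageI)
  then show "range (mat_vec I J A) \<subseteq> column_space I J A"
    by blast
  show "column_space I J A \<subseteq> range (mat_vec I J A)"
    unfolding column_space_def
  proof (rule cfun.span_minimal)
    show "(\<lambda>j i. if i \<in> I then A i j else 0) ` J \<subseteq> range (mat_vec I J A)"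
    proof safe
      fix j assume "j \<in> J"
      then have "(\<lambda>i. if i \<in> I then A i j else 0) = mat_vec I J A (\<lambda>k. if k = j then 1 else 0)"
        using assms by (auto simp: mat_vec_def if_distrib[of "\<lambda>x. _ * x"] cong: if_cong)
      then show "(\<lambda>i. if i \<in> I then A i j else 0) \<in> range (mat_vec I J A)"
        by simp
    qed
    show "cfun.subspace (range (mat_vec I J A))"
    proof (rule cfun.subspaceI)
      have "mat_vec I J A (\<lambda>_. 0) = 0"
        by (auto simp: mat_vec_def)
      then show "0 \<in> range (mat_vec I J A)"
        by (metis rangeI)
    next
      fix x y assume "x \<in> range (mat_vec I J A)" "y \<in> range (mat_vec I J A)"
      then obtain v w where "x = mat_vec I J A v" "y = mat_vec I J A w" by auto
      then have "x + y = mat_vec I J A (\<lambda>j. v j + w j)"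
        by (auto simp: mat_vec_def sum.distrib algebra_simps)
      then show "x + y \<in> range (mat_vec I J A)" by simp
    next
      fix c x assume "x \<in> range (mat_vec I J A)"
      then obtain v where "x = mat_vec I J A v" by auto
      then have "cscale c x = mat_vec I J A (cscale c v)"
        by (simp add: mat_vec_cscale)
      then show "cscale c x \<in> range (mat_vec I J A)" by simp
    qed
  qed
qed

lemma column_space_mat_times_subset:
  assumes "finite J" "finite K" "mat_eq I J A (mat_times K B C)"
  shows "column_space I J A \<subseteq> column_space I K B"
proof -
  have "mat_vec I J A v = mat_vec I K B (mat_vec K J C v)" for v
    using mat_vec_cong[OF assms(3), of v] by (simp add: mat_vec_mat_vec)
  then show ?thesis
    using assms(1,2) by (auto simp: column_space_eq_range)
qed

lemma subspace_column_space: "cfun.subspace (column_space I J A)"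
  unfolding column_space_def by (rule cfun.subspace_span)

lemma column_space_cspace: "finite J \<Longrightarrow> column_space I J A \<subseteq> cspace I"
  using mat_vec_cspace by (auto simp: column_space_eq_range)

text \<open>Two candidates for the projection differ by a vector of \<open>U\<close> that is
  orthogonal to itself, hence zero on \<open>I\<close>; off \<open>I\<close> it vanishes by
  membership in \<open>cspace I\<close>. This uniqueness discharges the definite description in
  \<open>orth_proj\<close>.\<close>

lemma orth_proj_eqI:
  assumes I: "finite I" and U: "cfun.subspace U" "U \<subseteq> cspace I"
    and p: "p \<in> U" "\<And>u. u \<in> U \<Longrightarrow> cdot I u (v - p) = 0"
  shows "orth_proj I U v = p"
  unfolding orth_proj_def
proof (rule the_equality)
  fix q assume q: "q \<in> U \<and> (\<forall>u\<in>U. cdot I u (v - q) = 0)"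
  have pq: "q - p \<in> U"
    using U(1) p(1) q by (simp add: cfun.subspace_diff)
  have "cdot I (q - p) (q - p) = cdot I (q - p) (v - p) - cdot I (q - p) (v - q)"
    by (simp add: cdot_def sum_subtractf[symmetric] algebra_simps)
  also have "\<dots> = 0"
    using p(2)[OF pq] q pq by simp
  finally have "(\<Sum>i\<in>I. complex_of_real ((cmod ((q - p) i))\<^sup>2)) = 0"
    by (simp add: cdot_def complex_norm_square mult.commute del: of_real_power)
  then have "complex_of_real (\<Sum>i\<in>I. (cmod ((q - p) i))\<^sup>2) = 0"
    by simp
  then have "(\<Sum>i\<in>I. (cmod ((q - p) i))\<^sup>2) = 0"
    unfolding of_real_eq_0_iff .
  then have "\<forall>i\<in>I. (q - p) i = 0"
    using I by (subst (asm) sum_nonneg_eq_0_iff) auto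
  moreover have "\<forall>i. i \<notin> I \<longrightarrow> (q - p) i = 0"
    using pq U(2) by (auto simp: cspace_def)
  ultimately show "q = p"
    by (auto simp: fun_eq_iff)
qed (use p in auto)

section \<open>Isometries: projections, dimensions and isoclinic pairs\<close>

definition isometry_mat :: "'i set \<Rightarrow> 'j set \<Rightarrow> ('i \<Rightarrow> 'j \<Rightarrow> complex) \<Rightarrow> bool" where
  "isometry_mat I J A \<longleftrightarrow> mat_eq J J (mat_times I (conj_transpose A) A) (scalar_mat 1)"

text \<open>Coefficient vectors are arbitrary functions, so the adjoint recovers \<open>w\<close>
  only after its values off \<open>J\<close> are cut to 0.\<close>

lemma isometry_mat_vec:
  assumes "finite J" "isometry_mat I J A"
  shows "mat_vec J I (conj_transpose A) (mat_vec I J A w) = (\<lambda>j. if j \<in> J then w j else 0)"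
  using assms mat_vec_cong[of J J _ "scalar_mat 1" w] mat_vec_diagonal[of J "scalar_mat 1" w]
  by (simp add: mat_vec_mat_vec isometry_mat_def diagonal_on_def) (simp add: scalar_mat_def fun_eq_iff)

lemma cdot_mat_vec:
  assumes "finite I" "finite J"
  shows "cdot I (mat_vec I J A w) v = cdot J w (mat_vec J I (conj_transpose A) v)"
  using sum.swap[of "\<lambda>j i. cnj (A i j) * cnj (w j) * v i" I J]
  by (simp add: cdot_def mat_vec_def conj_transpose_def sum_distrib_left sum_distrib_right mult_ac)

text \<open>The adjoint of \<open>A\<close> kills the residual \<open>v - ?p\<close> because it is a
  left inverse of \<open>A\<close>; by adjunction the residual is orthogonal to every
  column.\<close>

lemma orth_proj_column_space:
  assumes I: "finite I" and J: "finite J" and A: "isometry_mat I J A"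
  shows "orth_proj I (column_space I J A) v = mat_vec I J A (mat_vec J I (conj_transpose A) v)"
proof (rule orth_proj_eqI)
  let ?p = "mat_vec I J A (mat_vec J I (conj_transpose A) v)"
  fix u assume "u \<in> column_space I J A"
  then obtain w where u: "u = mat_vec I J A w"
    using J by (auto simp: column_space_eq_range)
  have "mat_vec J I (conj_transpose A) (v - ?p) =
      mat_vec J I (conj_transpose A) v - mat_vec J I (conj_transpose A) ?p"
    by (auto simp: mat_vec_def sum_subtractf algebra_simps)
  also have "\<dots> = 0"
    unfolding isometry_mat_vec[OF J A] by (auto simp: mat_vec_def)
  finally show "cdot I u (v - ?p) = 0"
    unfolding u cdot_mat_vec[OF I J] by (simp add: cdot_def)
qed (use I J in \<open>simp_all add: subspace_column_space column_space_cspace\<close>,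
    simp add: column_space_eq_range)

text \<open>The adjoint recovers the coefficients of a linear combination of columns. Injectivity of
  the column map is treated separately, because independence is a property of the set of columns, in
  which equal columns would merge.\<close>

lemma dim_column_space_isometry:
  assumes J: "finite J" and A: "isometry_mat I J A"
  shows "cfun.dim (column_space I J A) = card J"
proof -
  let ?col = "\<lambda>j i. if i \<in> I then A i j else 0"
  have col: "(\<Sum>j\<in>J. cscale (w j) (?col j)) = mat_vec I J A w" for w
    by (auto simp: mat_vec_def cscale_def sum_fun_apply fun_eq_iff mult.commute)
  have zero: "w j = 0" if "(\<Sum>j\<in>J. cscale (w j) (?col j)) = 0" "j \<in> J" for w j
    using isometry_mat_vec[OF J A, of w] that fun_cong[of _ _ j]
    by (force simp: col mat_vec_def fun_eq_iff split: if_splits)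
  have inj: "inj_on ?col J"
  proof (rule inj_onI, rule ccontr)
    fix j k assume *: "j \<in> J" "k \<in> J" "?col j = ?col k" "j \<noteq> k"
    \<comment> \<open>Two equal columns would cancel with coefficients 1 and -1, a nontrivial
      relation.\<close>
    let ?w = "\<lambda>l. if l = j then 1 else if l = k then -1 else 0 :: complex"
    have "(\<Sum>l\<in>J. cscale (?w l) (?col l)) = (\<Sum>l\<in>{j, k}. cscale (?w l) (?col l))"
      using J * by (intro sum.mono_neutral_right) (auto simp: cscale_def fun_eq_iff)
    also have "\<dots> = 0"
      using * by (auto simp: cscale_def fun_eq_iff)
    finally show False
      using zero[of ?w j] * by simp
  qed
  have "cfun.independent (?col ` J)"
  proof (rule cfun.independent_if_scalars_zero)
    fix f x assume "(\<Sum>x\<in>?col ` J. cscale (f x) x) = 0" and x: "x \<in> ?col ` J"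
    then have "(\<Sum>j\<in>J. cscale (f (?col j)) (?col j)) = 0"
      by (simp add: sum.reindex[OF inj])
    then show "f x = 0"
      using zero[of "\<lambda>j. f (?col j)"] x by blast
  qed (use J in simp)
  then have "cfun.dim (column_space I J A) = card (?col ` J)"
    unfolding column_space_def by (simp add: cfun.dim_eq_card_independent)
  then show ?thesis
    by (simp add: card_image inj)
qed

text \<open>With M the product of the adjoint of \<open>A\<close> and \<open>B\<close>, the operator
  P Q P is \<open>A\<close> times M times the adjoint of M times the adjoint of \<open>A\<close>.
  For diagonal M the middle product is the diagonal of squared moduli, to be compared with the
  scalar \<open>t\<close>.\<close>

lemma orth_proj_isoclinic_iff:
  assumes I: "finite I" and J: "finite J" and A: "isometry_mat I J A" and B: "isometry_mat I J B"
    and AB: "diagonal_on J (mat_times I (conj_transpose A) B)"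
  defines "P \<equiv> orth_proj I (column_space I J A)" and "Q \<equiv> orth_proj I (column_space I J B)"
  shows "(\<forall>v\<in>cspace I. P (Q (P v)) = cscale (complex_of_real t) (P v)) \<longleftrightarrow>
    (\<forall>j\<in>J. (cmod (mat_times I (conj_transpose A) B j j))\<^sup>2 = t)"
proof -
  let ?As = "mat_vec J I (conj_transpose A)" and ?Bs = "mat_vec J I (conj_transpose B)"
  let ?M = "mat_times I (conj_transpose A) B" and ?N = "mat_times I (conj_transpose B) A"
  have N: "?N j k = cnj (?M k j)" for j k
    by (simp add: mat_times_def conj_transpose_def mult.commute)
  have "diagonal_on J ?N"
    using AB by (simp add: N diagonal_on_def)
  have P: "P v = mat_vec I J A (?As v)" and Q: "Q v = mat_vec I J B (?Bs v)" for v
    using orth_proj_column_space I J A B by (auto simp: P_def Q_def)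
  have PQP: "P (Q (P v)) =
      mat_vec I J A (\<lambda>j. if j \<in> J then complex_of_real ((cmod (?M j j))\<^sup>2) * ?As v j else 0)" for v
  proof -
    have "P (Q (P v)) = mat_vec I J A (mat_vec J J ?M (mat_vec J J ?N (?As v)))"
      unfolding P Q by (simp only: mat_vec_mat_vec[symmetric])
    also have "mat_vec J J ?M (mat_vec J J ?N (?As v)) =
        (\<lambda>j. if j \<in> J then complex_of_real ((cmod (?M j j))\<^sup>2) * ?As v j else 0)"
      unfolding mat_vec_diagonal[OF J AB] mat_vec_diagonal[OF J \<open>diagonal_on J ?N\<close>] N
      by (auto simp: complex_norm_square simp del: of_real_power)
    finally show ?thesis .
  qed
  show ?thesis
  proof
    assume t: "\<forall>j\<in>J. (cmod (?M j j))\<^sup>2 = t"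
    have "(\<lambda>j. if j \<in> J then complex_of_real ((cmod (?M j j))\<^sup>2) * ?As v j else 0) =
        cscale (complex_of_real t) (?As v)" for v
      using t by (auto simp: mat_vec_def cscale_def fun_eq_iff)
    then show "\<forall>v\<in>cspace I. P (Q (P v)) = cscale (complex_of_real t) (P v)"
      unfolding PQP by (simp add: P mat_vec_cscale)
  next
    assume *: "\<forall>v\<in>cspace I. P (Q (P v)) = cscale (complex_of_real t) (P v)"
    show "\<forall>j\<in>J. (cmod (?M j j))\<^sup>2 = t"
    proof
      fix j assume j: "j \<in> J"
      \<comment> \<open>Testing on \<open>v\<close>, the \<open>j\<close>-th column of
        \<open>A\<close>, isolates the \<open>j\<close>-th diagonal entry.\<close>
      define e where "e k = (if k = j then 1 else 0 :: complex)" for k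
      define v where "v = mat_vec I J A e"
      have Asv: "?As v = (\<lambda>k. if k \<in> J then e k else 0)"
        unfolding v_def by (rule isometry_mat_vec[OF J A])
      have "v \<in> cspace I"
        unfolding v_def by (rule mat_vec_cspace)
      then have "?As (P (Q (P v))) = ?As (cscale (complex_of_real t) (P v))"
        using * by simp
      then have "?As (P (Q (P v))) j = complex_of_real t * ?As (P v) j"
        unfolding mat_vec_cscale by (simp add: cscale_def)
      moreover have "?As (P (Q (P v))) j = complex_of_real ((cmod (?M j j))\<^sup>2)"
        unfolding PQP isometry_mat_vec[OF J A] Asv using j by (simp add: e_def)
      moreover have "?As (P v) j = 1"
        unfolding P[of v] isometry_mat_vec[OF J A] Asv using j by (simp add: e_def)
      ultimately have "complex_of_real ((cmod (?M j j))\<^sup>2) = complex_of_real t"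
        by simp
      then show "(cmod (?M j j))\<^sup>2 = t"
        unfolding of_real_eq_iff .
    qed
  qed
qed

text \<open>Orthogonality sums over a whole group, whereas frame and matrices are indexed by cosets.
  The lemma is stated for any group since it serves both \<open>G\<close> modulo \<open>H\<close>
  and the dual group modulo the annihilator.\<close>

lemma (in group) sum_rcosets:
  fixes F :: "'a set \<Rightarrow> 'c :: comm_semiring_1"
  assumes "finite (carrier G)" "subgroup H G"
  shows "(\<Sum>x\<in>carrier G. F (H #> x)) = of_nat (card H) * (\<Sum>c\<in>rcosets H. F c)"
proof -
  have img: "rcosets H = (\<lambda>x. H #> x) ` carrier G"
    by (auto simp: RCOSETS_def)
  have "(\<Sum>x\<in>carrier G. F (H #> x)) = (\<Sum>c\<in>rcosets H. \<Sum>x | x \<in> carrier G \<and> H #> x = c. F (H #> x))"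
    using assms(1) unfolding img by (intro sum.group[symmetric]) auto
  also have "\<dots> = (\<Sum>c\<in>rcosets H. of_nat (card H) * F c)"
  proof (rule sum.cong[OF refl])
    fix c assume c: "c \<in> rcosets H"
    then obtain y where y: "y \<in> carrier G" "c = H #> y"
      by (auto simp: img)
    have "{x. x \<in> carrier G \<and> H #> x = c} = c"
      unfolding y(2) using y(1) assms(2) repr_independence[of _ H y] repr_independenceD[of H _ y]
        subgroup.elemrcos_carrier[OF assms(2) is_group] rcos_self[OF _ assms(2)] by blast
    moreover have "(\<Sum>x | x \<in> carrier G \<and> H #> x = c. F (H #> x)) =
        (\<Sum>x | x \<in> carrier G \<and> H #> x = c. F c)"
      by (rule sum.cong) auto
    ultimately show "(\<Sum>x | x \<in> carrier G \<and> H #> x = c. F (H #> x)) = of_nat (card H) * F c"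
      using card_rcosets_equal[OF c subgroup.subset[OF assms(2)]] by simp
  qed
  finally show ?thesis
    by (simp add: sum_distrib_left)
qed

section \<open>The fusion frame and the conference matrices\<close>

context fine_difference_set_setting
begin

section \<open>Gram matrices of \<open>E_mat\<close> and column spaces of
  \<open>Phi_mat\<close>\<close>

lemma normal_H: "H \<lhd> G"
  using subgroup_H by (rule subgroup_imp_normal)

lemma nonzero_cosets_eq: "nonzero_cosets G H = {H #> g | g. g \<in> carrier G \<and> g \<notin> H}"
proof -
  have "H #> g = H \<longleftrightarrow> g \<in> H" if "g \<in> carrier G" for g
    using rcos_self[OF that subgroup_H] subgroup.rcos_const[OF subgroup_H is_group] by auto
  then show ?thesis
    by (auto simp: nonzero_cosets_def FactGroup_def RCOSETS_def)
qed

lemma finite_nonzero_cosets [simp]: "finite (nonzero_cosets G H)"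
  by (simp add: nonzero_cosets_eq)

lemma card_cosets: "card (rcosets H) = s + 1"
  using lagrange[OF subgroup_H] order_eq card_H_pos by (metis mult_cancel2 less_irrefl)

lemma coset_D: "d \<in> D \<Longrightarrow> H #> d \<in> nonzero_cosets G H"
  using D_H by (auto simp: nonzero_cosets_eq)

text \<open>Column \<open>c\<close> of either matrix is supported on the elements of
  \<open>D\<close> in the coset \<open>c\<close>, so different columns have disjoint supports even
  for different characters.\<close>

lemma E_gram:
  assumes "\<gamma> \<in> carrier (dual_group G)" "c' \<in> nonzero_cosets G H"
  shows "mat_times D (conj_transpose (E_mat G H D \<gamma>)) (E_mat G H D \<gamma>') c c' =
    (if c = c' then complex_of_real (fine_S G D / real (card D)) *
       (\<Sum>d | d \<in> D \<and> H #> d = c. (inv\<^bsub>dual_group G\<^esub> \<gamma> \<otimes>\<^bsub>dual_group G\<^esub> \<gamma>') d) else 0)"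
proof -
  let ?k = "complex_of_real (fine_S G D / real (card D))"
  have "sqrt (fine_S G D) / sqrt (real (card D)) * (sqrt (fine_S G D) / sqrt (real (card D))) =
      fine_S G D / real (card D)"
    by (simp add: fine_S_eq)
  then have k: "complex_of_real (sqrt (fine_S G D) / sqrt (real (card D))) *
      complex_of_real (sqrt (fine_S G D) / sqrt (real (card D))) = ?k"
    by (metis of_real_mult)
  have "mat_times D (conj_transpose (E_mat G H D \<gamma>)) (E_mat G H D \<gamma>') c c' =
      (\<Sum>d\<in>D. if H #> d = c \<and> c = c' then ?k * (cnj (\<gamma> d) * \<gamma>' d) else 0)"
    unfolding mat_times_def conj_transpose_def E_mat_def k[symmetric]
    by (rule sum.cong) auto
  also have "\<dots> = (if c = c' then \<Sum>d | d \<in> D \<and> H #> d = c. ?k * (cnj (\<gamma> d) * \<gamma>' d) else 0)"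
    by (cases "c = c'") (simp_all add: sum.inter_filter del: of_real_divide)
  also have "\<dots> = (if c = c' then ?k *
       (\<Sum>d | d \<in> D \<and> H #> d = c. (inv\<^bsub>dual_group G\<^esub> \<gamma> \<otimes>\<^bsub>dual_group G\<^esub> \<gamma>') d) else 0)"
    using assms(1) by (simp add: sum_distrib_left dual_group_mult dual_group_inv_apply)
  finally show ?thesis .
qed

lemma E_gram_diagonal:
  assumes "\<gamma> \<in> carrier (dual_group G)"
  shows "diagonal_on (nonzero_cosets G H)
    (mat_times D (conj_transpose (E_mat G H D \<gamma>)) (E_mat G H D \<gamma>'))"
  using E_gram[OF assms] by (simp add: diagonal_on_def)

text \<open>For equal characters a diagonal entry is S / D times the fiber size, which is 1 by
  \<open>card_fiber\<close>.\<close>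

lemma isometry_E:
  assumes \<gamma>: "\<gamma> \<in> carrier (dual_group G)"
  shows "isometry_mat D (nonzero_cosets G H) (E_mat G H D \<gamma>)"
  unfolding isometry_mat_def mat_eq_def
proof (intro ballI)
  fix c c' assume c: "c \<in> nonzero_cosets G H" "c' \<in> nonzero_cosets G H"
  then obtain g where g: "g \<in> carrier G" "g \<notin> H" "c = H #> g"
    by (auto simp: nonzero_cosets_eq)
  have "(inv\<^bsub>dual_group G\<^esub> \<gamma> \<otimes>\<^bsub>dual_group G\<^esub> \<gamma>) d = 1" if "d \<in> D" for d
    using that \<gamma> by (simp add: dual_group_mult dual_group_inv_apply cnj_char_mult_self)
  then have "(\<Sum>d | d \<in> D \<and> H #> d = c. (inv\<^bsub>dual_group G\<^esub> \<gamma> \<otimes>\<^bsub>dual_group G\<^esub> \<gamma>) d) =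
      (\<Sum>d | d \<in> D \<and> H #> d = c. 1)"
    by (intro sum.cong) auto
  also have "complex_of_real (fine_S G D / real (card D)) * \<dots> =
      complex_of_real (real s * real (card (fiber g)) / real (card D))"
    using g by (simp add: fine_S_eq)
  also have "\<dots> = 1"
    using card_fiber[OF g(1,2)] D_nonempty by simp
  finally show "mat_times D (conj_transpose (E_mat G H D \<gamma>)) (E_mat G H D \<gamma>) c c' = scalar_mat 1 c c'"
    unfolding E_gram[OF \<gamma> c(2)] scalar_mat_def by (simp only:)
qed

text \<open>Row \<open>d\<close> of \<open>E_mat\<close> has one nonzero entry, at the coset of
  \<open>d\<close>; that coset is a nonzero one because \<open>D\<close> misses
  \<open>H\<close>.\<close>

lemma Phi_eq_E_Psi:
  "mat_eq D (annihilator G H) (Phi_mat D \<gamma>)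
     (mat_times (nonzero_cosets G H) (E_mat G H D \<gamma>) (Psi_mat G D))"
  unfolding mat_eq_def
proof (intro ballI)
  fix d \<delta> assume d: "d \<in> D" and \<delta>: "\<delta> \<in> annihilator G H"
  let ?k = "complex_of_real (sqrt (fine_S G D) / sqrt (real (card D)))"
  have "mat_times (nonzero_cosets G H) (E_mat G H D \<gamma>) (Psi_mat G D) d \<delta> =
      (\<Sum>c\<in>nonzero_cosets G H. if c = H #> d then ?k * \<gamma> d * Psi_mat G D (H #> d) \<delta> else 0)"
    unfolding mat_times_def E_mat_def by (rule sum.cong) auto
  also have "\<dots> = ?k * \<gamma> d * (complex_of_real (1 / sqrt (fine_S G D)) * \<delta> d)"
    using coset_D[OF d] Psi_mat_coset[OF is_group subgroup_H D_carrier[OF d] \<delta>, of D] by simp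
  also have "\<dots> = Phi_mat D \<gamma> d \<delta>"
    using s_pos by (simp add: Phi_mat_def fine_S_eq)
  finally show "Phi_mat D \<gamma> d \<delta> =
      mat_times (nonzero_cosets G H) (E_mat G H D \<gamma>) (Psi_mat G D) d \<delta>" ..
qed

lemma card_annihilator_eq: "card (annihilator G H) = s + 1"
  using card_annihilator[OF subgroup_H] order_eq card_H_pos by (metis mult_cancel2 less_irrefl)

text \<open>The columns of \<open>\<Psi>\<^sup>*\<close> are orthogonal, so \<open>\<Psi>\<close> has a right inverse proportional to \<open>\<Psi>\<^sup>*\<close>.\<close>

lemma E_eq_Phi_times:
  assumes \<gamma>: "\<gamma> \<in> carrier (dual_group G)"
  shows "mat_eq D (nonzero_cosets G H) (E_mat G H D \<gamma>)
    (mat_times (annihilator G H) (Phi_mat D \<gamma>)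
      (\<lambda>\<delta> c. complex_of_real (real s / real (s + 1)) * cnj (Psi_mat G D c \<delta>)))"
  unfolding mat_eq_def
proof (intro ballI)
  fix d c assume d: "d \<in> D" and c: "c \<in> nonzero_cosets G H"
  then obtain g where g: "g \<in> carrier G" "c = H #> g"
    by (auto simp: nonzero_cosets_eq)
  \<comment> \<open>The factors come from \<open>Phi_mat\<close>, from the normalisation, and from
    \<open>Psi_mat\<close>. A row of \<open>Psi_mat\<close> has \<open>s + 1\<close> entries of
    modulus 1 / sqrt s, hence squared norm (s + 1) / s; this explains the factor s / (s +
    1).\<close>
  let ?k = "complex_of_real (1 / sqrt (real (card D)) * (real s / real (s + 1)) * (1 / sqrt (real s)))"
  have "(\<Sum>\<delta>\<in>annihilator G H. Phi_mat D \<gamma> d \<delta> *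
        (complex_of_real (real s / real (s + 1)) * cnj (Psi_mat G D c \<delta>))) =
      (\<Sum>\<delta>\<in>annihilator G H. ?k * \<gamma> d * \<delta> (d \<otimes> inv g))"
  proof (rule sum.cong[OF refl])
    fix \<delta> assume \<delta>: "\<delta> \<in> annihilator G H"
    have "\<delta> (d \<otimes> inv g) = \<delta> d * cnj (\<delta> g)"
      using d g annihilator_dual[OF \<delta>] by (simp add: char_mult char_inv)
    then show "Phi_mat D \<gamma> d \<delta> *
        (complex_of_real (real s / real (s + 1)) * cnj (Psi_mat G D c \<delta>)) =
        ?k * \<gamma> d * \<delta> (d \<otimes> inv g)"
      using Psi_mat_coset[OF is_group subgroup_H g(1) \<delta>, of D]
      by (simp add: g(2) Phi_mat_def fine_S_eq mult_ac)
  qed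
  also have "\<dots> = ?k * \<gamma> d * (\<Sum>\<delta>\<in>annihilator G H. \<delta> (d \<otimes> inv g))"
    by (simp only: sum_distrib_left)
  also have "(\<Sum>\<delta>\<in>annihilator G H. \<delta> (d \<otimes> inv g)) =
      (if H #> d = c then complex_of_real (real (s + 1)) else 0)"
    using d g by (simp add: sum_annihilator[OF subgroup_H] rcos_eq_iff[OF subgroup_H]
        card_annihilator_eq)
  also have "?k * \<gamma> d * \<dots> = E_mat G H D \<gamma> d c"
  proof -
    have "1 / a * (x / q) * (1 / b) * q = x / b / a" if "q \<noteq> 0" for a b x q :: real
      using that by simp
    then have "1 / sqrt (real (card D)) * (real s / real (s + 1)) * (1 / sqrt (real s)) * real (s + 1) =
        real s / sqrt (real s) / sqrt (real (card D))"
      by simp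
    also have "\<dots> = sqrt (real s) / sqrt (real (card D))"
      by (simp add: real_div_sqrt)
    finally have "1 / sqrt (real (card D)) * (real s / real (s + 1)) * (1 / sqrt (real s)) * real (s + 1) =
        sqrt (real s) / sqrt (real (card D))" .
    then have "?k * complex_of_real (real (s + 1)) = complex_of_real (sqrt (real s) / sqrt (real (card D)))"
      by (metis of_real_mult)
    then show ?thesis
      by (auto simp: E_mat_def fine_S_eq mult_ac simp del: of_real_mult of_real_divide)
  qed
  finally show "E_mat G H D \<gamma> d c = mat_times (annihilator G H) (Phi_mat D \<gamma>)
      (\<lambda>\<delta> c. complex_of_real (real s / real (s + 1)) * cnj (Psi_mat G D c \<delta>)) d c"
    by (simp add: mat_times_def)
qed

text \<open>Each of \<open>Phi_mat\<close> and \<open>E_mat\<close> is the other one times a matrix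
  on the right, so each column space contains the other.\<close>

lemma U_space_eq:
  assumes "\<gamma> \<in> carrier (dual_group G)"
  shows "U_space G H D (annihilator G H #>\<^bsub>dual_group G\<^esub> \<gamma>) =
    column_space D (nonzero_cosets G H) (E_mat G H D \<gamma>)"
proof -
  have "column_space D (annihilator G H) (Phi_mat D \<gamma>) =
      column_space D (nonzero_cosets G H) (E_mat G H D \<gamma>)"
    using column_space_mat_times_subset[OF _ _ Phi_eq_E_Psi]
      column_space_mat_times_subset[OF _ _ E_eq_Phi_times[OF assms]] finite_annihilator
    by (simp add: subset_antisym)
  then show ?thesis
    using U_space_coset[OF comm_group_axioms subgroup_H D_subset assms] by simp
qed

text \<open>The kernel of the projection in coordinates. Its dependence on the character is confined
  to \<open>\<gamma> (d \<otimes> inv d')\<close>, ready for summation over the dual group.\<close>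

lemma orth_proj_U_space:
  assumes \<gamma>: "\<gamma> \<in> carrier (dual_group G)" and d: "d \<in> D"
  shows "orth_proj D (U_space G H D (annihilator G H #>\<^bsub>dual_group G\<^esub> \<gamma>)) v d =
    complex_of_real (real s / real (card D)) * (\<Sum>d'\<in>fiber d. \<gamma> (d \<otimes> inv d') * v d')"
proof -
  let ?k = "complex_of_real (sqrt (fine_S G D) / sqrt (real (card D)))"
  let ?w = "mat_vec (nonzero_cosets G H) D (conj_transpose (E_mat G H D \<gamma>)) v"
  have k: "?k * ?k = complex_of_real (real s / real (card D))"
    by (simp add: fine_S_eq flip: of_real_mult)
  have "orth_proj D (U_space G H D (annihilator G H #>\<^bsub>dual_group G\<^esub> \<gamma>)) v d =
      (\<Sum>c\<in>nonzero_cosets G H. E_mat G H D \<gamma> d c * ?w c)"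
    unfolding U_space_eq[OF \<gamma>]
    using d orth_proj_column_space[OF finite_D finite_nonzero_cosets isometry_E[OF \<gamma>], of v]
    by (simp add: mat_vec_def[of D])
  also have "\<dots> = (\<Sum>c\<in>nonzero_cosets G H. if c = H #> d then ?k * \<gamma> d * ?w (H #> d) else 0)"
    by (rule sum.cong) (auto simp: E_mat_def)
  also have "\<dots> = ?k * \<gamma> d * ?w (H #> d)"
    using coset_D[OF d] by simp
  also have "?w (H #> d) = (\<Sum>d'\<in>D. cnj (E_mat G H D \<gamma> d' (H #> d)) * v d')"
    using coset_D[OF d] by (simp add: mat_vec_def conj_transpose_def)
  also have "\<dots> = (\<Sum>d'\<in>D. if H #> d' = H #> d then ?k * cnj (\<gamma> d') * v d' else 0)"
    by (rule sum.cong) (auto simp: E_mat_def)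
  also have "\<dots> = (\<Sum>d'\<in>fiber d. ?k * cnj (\<gamma> d') * v d')"
    by (rule sum.inter_filter[symmetric]) simp
  also have "?k * \<gamma> d * \<dots> = (?k * ?k) * (\<Sum>d'\<in>fiber d. \<gamma> (d \<otimes> inv d') * v d')"
    using d \<gamma> by (simp add: sum_distrib_left char_mult char_inv mult_ac del: of_real_divide)
  finally show ?thesis
    unfolding k .
qed

section \<open>Tightness\<close>

lemma carrier_dual_quotient:
  "carrier (dual_group G Mod annihilator G H) =
    {annihilator G H #>\<^bsub>dual_group G\<^esub> \<gamma> | \<gamma>. \<gamma> \<in> carrier (dual_group G)}"
  by (auto simp: FactGroup_def RCOSETS_def)

text \<open>Summing over all characters instead of cosets multiplies by \<open>s + 1\<close>, the
  order of the annihilator. Orthogonality keeps only \<open>d' = d\<close> with weight |G| = (s + 1)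
  |H|, which leaves the frame constant S |H| / D.\<close>

lemma sum_orth_proj_U_space:
  assumes v: "v \<in> cspace D"
  shows "(\<Sum>\<Gamma>\<in>carrier (dual_group G Mod annihilator G H). orth_proj D (U_space G H D \<Gamma>) v) =
    cscale (complex_of_real (real s * real (card H) / real (card D))) v"
proof
  fix d
  let ?X = "dual_group G" and ?A = "annihilator G H"
  interpret X: comm_group ?X
    by (rule comm_group_dual_group) unfold_locales
  let ?P = "\<lambda>\<Gamma>. orth_proj D (U_space G H D \<Gamma>) v"
  let ?k = "complex_of_real (real s / real (card D))"
  show "(\<Sum>\<Gamma>\<in>carrier (?X Mod ?A). ?P \<Gamma>) d =
      cscale (complex_of_real (real s * real (card H) / real (card D))) v d"
  proof (cases "d \<in> D")
    case False
    have "?P \<Gamma> d = 0" if \<Gamma>: "\<Gamma> \<in> carrier (?X Mod ?A)" for \<Gamma>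
    proof -
      obtain \<gamma> where \<gamma>: "\<gamma> \<in> carrier ?X" "\<Gamma> = ?A #>\<^bsub>?X\<^esub> \<gamma>"
        using \<Gamma> by (auto simp: carrier_dual_quotient)
      show ?thesis
        using orth_proj_column_space[OF finite_D finite_nonzero_cosets isometry_E[OF \<gamma>(1)], of v]
          False by (simp add: \<gamma>(2) U_space_eq[OF \<gamma>(1)] mat_vec_def[of D])
    qed
    then show ?thesis
      using False v by (simp add: sum_fun_apply cscale_def cspace_def)
  next
    case d: True
    have "of_nat (s + 1) * (\<Sum>\<Gamma>\<in>carrier (?X Mod ?A). ?P \<Gamma> d) = (\<Sum>\<gamma>\<in>carrier ?X. ?P (?A #>\<^bsub>?X\<^esub> \<gamma>) d)"
      using X.sum_rcosets[OF finite_dual_group subgroup_annihilator[OF comm_group_axioms subgroup_H],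
          of "\<lambda>\<Gamma>. ?P \<Gamma> d"]
      by (simp add: card_annihilator_eq FactGroup_def)
    also have "\<dots> = (\<Sum>\<gamma>\<in>carrier ?X. ?k * (\<Sum>d'\<in>fiber d. \<gamma> (d \<otimes> inv d') * v d'))"
      using orth_proj_U_space[OF _ d] by (intro sum.cong) auto
    also have "\<dots> = ?k * (\<Sum>d'\<in>fiber d. (\<Sum>\<gamma>\<in>carrier ?X. \<gamma> (d \<otimes> inv d')) * v d')"
      by (simp only: sum_distrib_left[symmetric] sum_distrib_right, subst sum.swap) (rule refl)
    also have "(\<Sum>d'\<in>fiber d. (\<Sum>\<gamma>\<in>carrier ?X. \<gamma> (d \<otimes> inv d')) * v d') =
        (\<Sum>d'\<in>fiber d. if d' = d then of_nat (order G) * v d else 0)"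
      using d by (intro sum.cong) (auto simp: sum_dual_group mult_inv_eq_one_iff)
    also have "\<dots> = of_nat (s + 1) * of_nat (card H) * v d"
      using d by (simp only: order_eq[symmetric] of_nat_mult) simp
    finally have "of_nat (s + 1) * (\<Sum>\<Gamma>\<in>carrier (?X Mod ?A). ?P \<Gamma> d) =
        of_nat (s + 1) * (?k * of_nat (card H) * v d)"
      by (simp only: mult_ac)
    moreover have "of_nat (s + 1) \<noteq> (0 :: complex)"
      by (simp only: of_nat_eq_0_iff)
    ultimately have "(\<Sum>\<Gamma>\<in>carrier (?X Mod ?A). ?P \<Gamma> d) = ?k * of_nat (card H) * v d"
      by (simp only: mult_cancel_left) simp
    then show ?thesis
      by (simp add: sum_fun_apply cscale_def)
  qed
qed

lemma tight_fusion_frame_U_space: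
  "tight_fusion_frame D (carrier (dual_group G Mod annihilator G H)) (U_space G H D)"
proof -
  let ?N = "carrier (dual_group G Mod annihilator G H)"
  have U: "\<exists>\<gamma>\<in>carrier (dual_group G). U_space G H D \<Gamma> =
      column_space D (nonzero_cosets G H) (E_mat G H D \<gamma>)" if "\<Gamma> \<in> ?N" for \<Gamma>
    using that U_space_eq by (auto simp: carrier_dual_quotient)
  have "cfun.subspace (U_space G H D \<Gamma>) \<and> U_space G H D \<Gamma> \<subseteq> cspace D \<and>
      cfun.dim (U_space G H D \<Gamma>) = card (nonzero_cosets G H)" if "\<Gamma> \<in> ?N" for \<Gamma>
    using U[OF that] subspace_column_space column_space_cspace[OF finite_nonzero_cosets]
      dim_column_space_isometry[OF finite_nonzero_cosets isometry_E] by metis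
  moreover have "finite ?N"
    using finite_dual_group by (simp add: carrier_dual_quotient)
  moreover have "real s * real (card H) / real (card D) > 0"
    using s_pos card_H_pos card_D_pos by simp
  ultimately show ?thesis
    unfolding tight_fusion_frame_def using sum_orth_proj_U_space finite_D by metis
qed

section \<open>Equi-isoclinic subspaces and the difference sets \<open>D_g\<close>\<close>

lemma annihilator_coset_eq_iff:
  assumes "\<gamma> \<in> carrier (dual_group G)" "\<gamma>' \<in> carrier (dual_group G)"
  shows "annihilator G H #>\<^bsub>dual_group G\<^esub> \<gamma> = annihilator G H #>\<^bsub>dual_group G\<^esub> \<gamma>' \<longleftrightarrow>
    inv\<^bsub>dual_group G\<^esub> \<gamma> \<otimes>\<^bsub>dual_group G\<^esub> \<gamma>' \<in> annihilator G H"
proof -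
  interpret X: comm_group "dual_group G"
    by (rule comm_group_dual_group) unfold_locales
  have "annihilator G H #>\<^bsub>dual_group G\<^esub> \<gamma>' = annihilator G H #>\<^bsub>dual_group G\<^esub> \<gamma> \<longleftrightarrow>
      \<gamma>' \<otimes>\<^bsub>dual_group G\<^esub> inv\<^bsub>dual_group G\<^esub> \<gamma> \<in> annihilator G H"
    using X.rcos_eq_iff[OF subgroup_annihilator[OF comm_group_axioms subgroup_H]] assms by blast
  then show ?thesis
    using assms by (auto simp: X.m_comm)
qed

text \<open>Tightness always holds, so only the isoclinic condition remains. A pair of characters
  enters it through the quotient alone, and distinct cosets correspond to quotients outside the
  annihilator.\<close>

lemma eitff_iff_const:
  "eitff D (carrier (dual_group G Mod annihilator G H)) (U_space G H D) \<longleftrightarrow>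
    (\<exists>t. \<forall>\<gamma>\<in>carrier (dual_group G) - annihilator G H. \<forall>g\<in>carrier G - H.
       (cmod (\<Sum>h\<in>shifted_part G H D g. \<gamma> h))\<^sup>2 = t)"
proof -
  let ?X = "dual_group G" and ?A = "annihilator G H" and ?C = "nonzero_cosets G H"
  let ?k = "real s / real (card D)"
  let ?M = "\<lambda>\<gamma> \<gamma>'. mat_times D (conj_transpose (E_mat G H D \<gamma>)) (E_mat G H D \<gamma>')"
  interpret X: comm_group ?X
    by (rule comm_group_dual_group) unfold_locales
  have k: "?k > 0"
    using s_pos card_D_pos by simp
  have M: "(cmod (?M \<gamma> \<gamma>' (H #> g) (H #> g)))\<^sup>2 =
      ?k\<^sup>2 * (cmod (\<Sum>h\<in>shifted_part G H D g. (inv\<^bsub>?X\<^esub> \<gamma> \<otimes>\<^bsub>?X\<^esub> \<gamma>') h))\<^sup>2"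
    if "\<gamma> \<in> carrier ?X" "\<gamma>' \<in> carrier ?X" "g \<in> carrier G" "g \<notin> H" for \<gamma> \<gamma>' g
  proof -
    have \<delta>: "inv\<^bsub>?X\<^esub> \<gamma> \<otimes>\<^bsub>?X\<^esub> \<gamma>' \<in> carrier ?X"
      using that by simp
    have "H #> g \<in> ?C"
      using that by (auto simp: nonzero_cosets_eq)
    then show ?thesis
      using E_gram[OF that(1), of "H #> g" \<gamma>' "H #> g"] sum_fiber[OF that(3) \<delta>] norm_char[OF \<delta> that(3)]
      by (simp add: fine_S_eq norm_mult norm_divide power_mult_distrib power_divide)
  qed
  define R where "R \<Gamma> \<Gamma>' t \<longleftrightarrow> (\<forall>v\<in>cspace D.
      orth_proj D (U_space G H D \<Gamma>) (orth_proj D (U_space G H D \<Gamma>') (orth_proj D (U_space G H D \<Gamma>) v)) =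
      cscale (complex_of_real t) (orth_proj D (U_space G H D \<Gamma>) v))" for \<Gamma> \<Gamma>' and t :: real
  have eitff_R: "eitff D (carrier (?X Mod ?A)) (U_space G H D) \<longleftrightarrow>
      (\<exists>\<sigma>\<ge>0. \<forall>\<Gamma>\<in>carrier (?X Mod ?A). \<forall>\<Gamma>'\<in>carrier (?X Mod ?A). \<Gamma> \<noteq> \<Gamma>' \<longrightarrow> R \<Gamma> \<Gamma>' (\<sigma>\<^sup>2))"
    using tight_fusion_frame_U_space by (simp only: eitff_def R_def simp_thms)
  have iso: "R (?A #>\<^bsub>?X\<^esub> \<gamma>) (?A #>\<^bsub>?X\<^esub> \<gamma>') t \<longleftrightarrow>
      (\<forall>g\<in>carrier G - H.
        ?k\<^sup>2 * (cmod (\<Sum>h\<in>shifted_part G H D g. (inv\<^bsub>?X\<^esub> \<gamma> \<otimes>\<^bsub>?X\<^esub> \<gamma>') h))\<^sup>2 = t)"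
    if "\<gamma> \<in> carrier ?X" "\<gamma>' \<in> carrier ?X" for \<gamma> \<gamma>' t
    unfolding R_def U_space_eq[OF that(1)] U_space_eq[OF that(2)]
      orth_proj_isoclinic_iff[OF finite_D finite_nonzero_cosets isometry_E[OF that(1)]
        isometry_E[OF that(2)] E_gram_diagonal[OF that(1)]]
    using M[OF that] by (force simp: nonzero_cosets_eq)
  show ?thesis
  proof
    assume "eitff D (carrier (?X Mod ?A)) (U_space G H D)"
    then obtain \<sigma> :: real where \<sigma>: "\<And>\<Gamma> \<Gamma>'. \<Gamma> \<in> carrier (?X Mod ?A) \<Longrightarrow> \<Gamma>' \<in> carrier (?X Mod ?A) \<Longrightarrow>
        \<Gamma> \<noteq> \<Gamma>' \<Longrightarrow> R \<Gamma> \<Gamma>' (\<sigma>\<^sup>2)"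
      unfolding eitff_R by blast
    have "(cmod (\<Sum>h\<in>shifted_part G H D g. \<gamma> h))\<^sup>2 = \<sigma>\<^sup>2 / ?k\<^sup>2"
      if \<gamma>: "\<gamma> \<in> carrier ?X" "\<gamma> \<notin> ?A" and g: "g \<in> carrier G" "g \<notin> H" for \<gamma> g
    proof -
      \<comment> \<open>Pairing with the trivial character realises any \<open>\<gamma>\<close> as a
        quotient.\<close>
      have one: "inv\<^bsub>?X\<^esub> \<one>\<^bsub>?X\<^esub> \<otimes>\<^bsub>?X\<^esub> \<gamma> = \<gamma>"
        using \<gamma> by simp
      have ne: "?A #>\<^bsub>?X\<^esub> \<one>\<^bsub>?X\<^esub> \<noteq> ?A #>\<^bsub>?X\<^esub> \<gamma>"
        using annihilator_coset_eq_iff[OF X.one_closed \<gamma>(1)] \<gamma>(2) unfolding one by blast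
      have mem: "?A #>\<^bsub>?X\<^esub> \<delta> \<in> carrier (?X Mod ?A)" if "\<delta> \<in> carrier ?X" for \<delta>
        unfolding carrier_dual_quotient using that by blast
      have "?k\<^sup>2 * (cmod (\<Sum>h\<in>shifted_part G H D g. \<gamma> h))\<^sup>2 = \<sigma>\<^sup>2"
        using iso[OF X.one_closed \<gamma>(1), THEN iffD1, OF \<sigma>[OF mem[OF X.one_closed] mem[OF \<gamma>(1)] ne]] g
        unfolding one by blast
      then show ?thesis
        using s_pos D_nonempty by (simp add: eq_divide_eq mult.commute)
    qed
    then show "\<exists>t. \<forall>\<gamma>\<in>carrier ?X - ?A. \<forall>g\<in>carrier G - H.
       (cmod (\<Sum>h\<in>shifted_part G H D g. \<gamma> h))\<^sup>2 = t"
      by blast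
  next
    assume "\<exists>t. \<forall>\<gamma>\<in>carrier ?X - ?A. \<forall>g\<in>carrier G - H.
       (cmod (\<Sum>h\<in>shifted_part G H D g. \<gamma> h))\<^sup>2 = t"
    then obtain t where t: "\<And>\<gamma> g. \<gamma> \<in> carrier ?X \<Longrightarrow> \<gamma> \<notin> ?A \<Longrightarrow> g \<in> carrier G \<Longrightarrow> g \<notin> H \<Longrightarrow>
       (cmod (\<Sum>h\<in>shifted_part G H D g. \<gamma> h))\<^sup>2 = t"
      by blast
    \<comment> \<open>Gram entries carry the factor S / D. The absolute value covers a vacuous
      condition on \<open>t\<close>, as for trivial \<open>H\<close>; otherwise \<open>t\<close> is
      a squared modulus.\<close>
    define \<sigma> where "\<sigma> = ?k * sqrt \<bar>t\<bar>"
    have \<sigma>: "\<sigma> \<ge> 0" "\<sigma>\<^sup>2 = ?k\<^sup>2 * \<bar>t\<bar>"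
      using k by (auto simp: \<sigma>_def power_mult_distrib power_divide)
    have "R \<Gamma> \<Gamma>' (\<sigma>\<^sup>2)"
      if \<Gamma>: "\<Gamma> \<in> carrier (?X Mod ?A)" "\<Gamma>' \<in> carrier (?X Mod ?A)" "\<Gamma> \<noteq> \<Gamma>'" for \<Gamma> \<Gamma>'
    proof -
      obtain \<gamma> \<gamma>' where \<gamma>: "\<gamma> \<in> carrier ?X" "\<Gamma> = ?A #>\<^bsub>?X\<^esub> \<gamma>"
        and \<gamma>': "\<gamma>' \<in> carrier ?X" "\<Gamma>' = ?A #>\<^bsub>?X\<^esub> \<gamma>'"
        using \<Gamma> by (auto simp: carrier_dual_quotient)
      have \<delta>: "inv\<^bsub>?X\<^esub> \<gamma> \<otimes>\<^bsub>?X\<^esub> \<gamma>' \<notin> ?A"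
        using \<Gamma>(3) annihilator_coset_eq_iff \<gamma> \<gamma>' by simp
      have "?k\<^sup>2 * (cmod (\<Sum>h\<in>shifted_part G H D g. (inv\<^bsub>?X\<^esub> \<gamma> \<otimes>\<^bsub>?X\<^esub> \<gamma>') h))\<^sup>2 = \<sigma>\<^sup>2"
        if "g \<in> carrier G - H" for g
      proof -
        have eq: "(cmod (\<Sum>h\<in>shifted_part G H D g. (inv\<^bsub>?X\<^esub> \<gamma> \<otimes>\<^bsub>?X\<^esub> \<gamma>') h))\<^sup>2 = t"
          using t[OF _ \<delta>] \<gamma>(1) \<gamma>'(1) that by simp
        moreover have "t \<ge> 0"
          unfolding eq[symmetric] by simp
        ultimately show ?thesis
          by (simp add: \<sigma>(2))
      qed
      then show ?thesis
        using iso[OF \<gamma>(1) \<gamma>'(1), of "\<sigma>\<^sup>2"] unfolding \<gamma>(2) \<gamma>'(2) by blast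
    qed
    then show "eitff D (carrier (?X Mod ?A)) (U_space G H D)"
      unfolding eitff_R using \<sigma>(1) by blast
  qed
qed

lemma annihilator_eq_dual_if_trivial:
  assumes "H = {\<one>}"
  shows "annihilator G H = carrier (dual_group G)"
  unfolding assms by (rule annihilator_trivial)

lemma norm_sum_shifted_part:
  assumes diff: "difference_set (G\<lparr>carrier := H\<rparr>) (shifted_part G H D g)"
    and g: "g \<in> carrier G" "g \<notin> H" and \<gamma>: "\<gamma> \<in> carrier (dual_group G)" "\<gamma> \<notin> annihilator G H"
  shows "(cmod (\<Sum>h\<in>shifted_part G H D g. \<gamma> h))\<^sup>2 = (real (card D))\<^sup>2 / real s ^ 3"
proof -
  obtain l where l: "\<And>h. h \<in> H \<Longrightarrow> h \<noteq> \<one> \<Longrightarrow> difference_count G (shifted_part G H D g) h = l"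
    using diff by (auto simp: shifted_part_difference_set_iff)
  \<comment> \<open>For trivial \<open>H\<close> every character lies in the annihilator, so the
    existence of \<open>\<gamma>\<close> excludes this case.\<close>
  have "H \<noteq> {\<one>}"
    using \<gamma> annihilator_eq_dual_if_trivial by auto
  then have "real s * (real (card (fiber g)) - real l) = (real (card (fiber g)))\<^sup>2"
    using shifted_part_index[OF g _ l] by blast
  then have "real (card (fiber g)) - real l = (real (card (fiber g)))\<^sup>2 / real s"
    using s_pos by (simp add: eq_divide_eq mult.commute)
  also have "\<dots> = (real (card D))\<^sup>2 / real s ^ 3"
    using s_pos unfolding card_fiber[OF g, symmetric]
    by (simp add: power_mult_distrib power2_eq_square power3_eq_cube)
  finally have "real (card (fiber g)) - real l = (real (card D))\<^sup>2 / real s ^ 3" .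
  moreover have "(cmod (\<Sum>h\<in>shifted_part G H D g. \<gamma> h))\<^sup>2 = real (card (fiber g)) - real l"
    using norm_sum_char_difference_set[OF subgroup_H shifted_part_subset l \<gamma>] card_shifted_part[OF g(1)]
    by simp
  ultimately show ?thesis
    by simp
qed

text \<open>For \<open>g \<in> H\<close> the set is empty. Otherwise, in Fourier inversion at
  \<open>h \<noteq> \<one>\<close>, characters in the annihilator contribute the squared size
  \<open>m\<close> and all others \<open>t\<close>. Writing this as \<open>t\<close> everywhere plus
  \<open>m - t\<close> on the annihilator, the first part sums to 0 and the second does not depend
  on \<open>h\<close>.\<close>

lemma shifted_part_difference_set_if_const:
  assumes t: "\<And>\<gamma> g. \<gamma> \<in> carrier (dual_group G) \<Longrightarrow> \<gamma> \<notin> annihilator G H \<Longrightarrow>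
      g \<in> carrier G \<Longrightarrow> g \<notin> H \<Longrightarrow> (cmod (\<Sum>h\<in>shifted_part G H D g. \<gamma> h))\<^sup>2 = t"
    and g: "g \<in> carrier G"
  shows "difference_set (G\<lparr>carrier := H\<rparr>) (shifted_part G H D g)"
proof (cases "g \<in> H")
  case True
  then have "shifted_part G H D g = {}"
    using bij_betw_fiber[OF g] fiber_subgroup[OF True] by (simp add: bij_betw_def)
  then show ?thesis
    by (auto simp: difference_set_def)
next
  case False
  let ?X = "dual_group G" and ?A = "annihilator G H" and ?B = "shifted_part G H D g"
  define m where "m = (real (card ?B))\<^sup>2"
  have B: "?B \<subseteq> carrier G"
    using shifted_part_subset[of g] H_carrier by blast
  have count: "of_nat (order G) * of_nat (difference_count G ?B h) =
      complex_of_real (real (s + 1) * (m - t))" if h: "h \<in> H" "h \<noteq> \<one>" for h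
  proof -
    have hG: "h \<in> carrier G" and hinv: "inv h \<noteq> \<one>"
      using h inv_eq_1_iff by auto
    have sub: "?A \<subseteq> carrier ?X"
      by (auto simp: annihilator_def)
    have "cnj (\<gamma> h) * complex_of_real ((cmod (\<Sum>d\<in>?B. \<gamma> d))\<^sup>2) =
        \<gamma> (inv h) * complex_of_real t + (if \<gamma> \<in> ?A then complex_of_real (m - t) else 0)"
      if \<gamma>: "\<gamma> \<in> carrier ?X" for \<gamma>
    proof (cases "\<gamma> \<in> ?A")
      case True
      then have one: "\<gamma> d = 1" if "d \<in> H" for d
        using that by (auto simp: annihilator_def)
      have "(\<Sum>d\<in>?B. \<gamma> d) = (\<Sum>d\<in>?B. 1)"
        using one shifted_part_subset by (intro sum.cong) auto
      then show ?thesis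
        using True one[OF h(1)] char_inv[OF \<gamma> hG] by (simp add: m_def)
    next
      case False
      then show ?thesis
        using t[OF \<gamma> False g \<open>g \<notin> H\<close>] char_inv[OF \<gamma> hG] by simp
    qed
    then have "of_nat (order G) * of_nat (difference_count G ?B h) =
        (\<Sum>\<gamma>\<in>carrier ?X. \<gamma> (inv h) * complex_of_real t + (if \<gamma> \<in> ?A then complex_of_real (m - t) else 0))"
      using difference_count_fourier[OF B hG] by (simp cong: sum.cong)
    also have "\<dots> = (\<Sum>\<gamma>\<in>carrier ?X. \<gamma> (inv h)) * complex_of_real t +
        of_nat (card ?A) * complex_of_real (m - t)"
      using sub finite_dual_group
      by (simp add: sum.distrib sum_distrib_right sum.If_cases Int_absorb1)
    finally show ?thesis
      using hG hinv by (simp add: sum_dual_group card_annihilator_eq)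
  qed
  have eq: "difference_count G ?B h = difference_count G ?B h'" if "h \<in> H - {\<one>}" "h' \<in> H - {\<one>}" for h h'
  proof -
    have "complex_of_nat (order G) * of_nat (difference_count G ?B h) =
        of_nat (order G) * of_nat (difference_count G ?B h')"
      using count that by simp
    then show ?thesis
      using order_pos by (simp only: mult_cancel_left of_nat_eq_iff of_nat_eq_0_iff) simp
  qed
  then show ?thesis
    unfolding shifted_part_difference_set_iff by blast
qed

lemma eitff_iff_difference_sets:
  "eitff D (carrier (dual_group G Mod annihilator G H)) (U_space G H D) \<longleftrightarrow>
    (\<forall>g\<in>carrier G. difference_set (G\<lparr>carrier := H\<rparr>) (shifted_part G H D g))"
  unfolding eitff_iff_const
proof
  assume "\<exists>t. \<forall>\<gamma>\<in>carrier (dual_group G) - annihilator G H. \<forall>g\<in>carrier G - H.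
       (cmod (\<Sum>h\<in>shifted_part G H D g. \<gamma> h))\<^sup>2 = t"
  then obtain t where "\<And>\<gamma> g. \<gamma> \<in> carrier (dual_group G) \<Longrightarrow> \<gamma> \<notin> annihilator G H \<Longrightarrow>
      g \<in> carrier G \<Longrightarrow> g \<notin> H \<Longrightarrow> (cmod (\<Sum>h\<in>shifted_part G H D g. \<gamma> h))\<^sup>2 = t"
    by blast
  then show "\<forall>g\<in>carrier G. difference_set (G\<lparr>carrier := H\<rparr>) (shifted_part G H D g)"
    using shifted_part_difference_set_if_const by blast
next
  assume "\<forall>g\<in>carrier G. difference_set (G\<lparr>carrier := H\<rparr>) (shifted_part G H D g)"
  then show "\<exists>t. \<forall>\<gamma>\<in>carrier (dual_group G) - annihilator G H. \<forall>g\<in>carrier G - H.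
       (cmod (\<Sum>h\<in>shifted_part G H D g. \<gamma> h))\<^sup>2 = t"
    using norm_sum_shifted_part by blast
qed

text \<open>The relation S (k - \<lambda>) = k^2 for the integer k = D / S shows that S divides k^2;
  multiplying by S^2 gives the claim, since D = S k.\<close>

lemma s_cubed_dvd:
  assumes diff: "\<forall>g\<in>carrier G. difference_set (G\<lparr>carrier := H\<rparr>) (shifted_part G H D g)"
    and H: "H \<noteq> {\<one>}"
  shows "s ^ 3 dvd card D ^ 2"
proof -
  obtain g where "g \<in> D"
    using D_nonempty by blast
  then have g: "g \<in> carrier G" "g \<notin> H"
    using D_H by auto
  define k where "k = card (fiber g)"
  obtain l where l: "\<And>h. h \<in> H \<Longrightarrow> h \<noteq> \<one> \<Longrightarrow> difference_count G (shifted_part G H D g) h = l"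
    using diff g(1) by (auto simp: shifted_part_difference_set_iff)
  \<comment> \<open>The term with \<open>l\<close> is moved to the other side, so that the equation
    transfers to natural numbers without truncated subtraction.\<close>
  have "real s * real k = real k ^ 2 + real s * real l"
    using shifted_part_index[OF g H l] by (simp add: k_def algebra_simps)
  then have "real (s * k) = real (k ^ 2 + s * l)"
    by simp
  then have "s * k = k ^ 2 + s * l"
    by (simp only: of_nat_eq_iff)
  then have "s dvd k ^ 2 + s * l"
    by (metis dvd_triv_left)
  then have "s dvd k ^ 2"
    by (simp add: dvd_add_left_iff)
  then have "s\<^sup>2 * s dvd s\<^sup>2 * k\<^sup>2"
    by (rule mult_dvd_mono[OF dvd_refl])
  then show ?thesis
    using card_D_eq[OF g] by (simp add: k_def power_mult_distrib power2_eq_square power3_eq_cube mult.assoc)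
qed

section \<open>Conference matrices\<close>

lemma FactGroup_div:
  assumes "x \<in> carrier G" "y \<in> carrier G"
  shows "(H #> x) \<otimes>\<^bsub>G Mod H\<^esub> inv\<^bsub>G Mod H\<^esub> (H #> y) = H #> (x \<otimes> inv y)"
proof -
  interpret N: normal H G by (rule normal_H)
  have "H #> y \<in> carrier (G Mod H)"
    using assms by (auto simp: carrier_FactGroup)
  then show ?thesis
    using assms by (simp add: N.inv_FactGroup N.rcos_inv N.rcos_sum)
qed

lemma C_mat_coset:
  assumes "x \<in> carrier G" "y \<in> carrier G"
  shows "C_mat G H D \<gamma> (H #> x) (H #> y) =
    complex_of_real (real s powr (3/2) / real (card D)) * (\<Sum>d\<in>fiber (x \<otimes> inv y). \<gamma> d)"
  unfolding C_mat_def FactGroup_div[OF assms] fine_S_eq ..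

text \<open>Fibers over nonzero cosets have character sums of modulus D / S^(3/2), the reciprocal of
  the normalising constant; the fiber over the zero coset is empty.\<close>

lemma norm_C_mat:
  assumes diff: "\<forall>g\<in>carrier G. difference_set (G\<lparr>carrier := H\<rparr>) (shifted_part G H D g)"
    and \<gamma>: "\<gamma> \<in> carrier (dual_group G)" "\<gamma> \<notin> annihilator G H"
    and x: "x \<in> carrier G" and y: "y \<in> carrier G"
  shows "cmod (C_mat G H D \<gamma> (H #> x) (H #> y)) = (if H #> x = H #> y then 0 else 1)"
proof (cases "x \<otimes> inv y \<in> H")
  case True
  then show ?thesis
    using rcos_eq_iff[OF subgroup_H x y] fiber_subgroup[OF True]
    by (simp only: C_mat_coset[OF x y]) simp
next
  case False
  have g: "x \<otimes> inv y \<in> carrier G"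
    using x y by simp
  have "(cmod (\<Sum>d\<in>fiber (x \<otimes> inv y). \<gamma> d))\<^sup>2 = (real (card D))\<^sup>2 / real s ^ 3"
    using norm_sum_shifted_part[OF _ g False \<gamma>] diff g norm_char[OF \<gamma>(1) g]
    by (simp add: sum_fiber[OF g \<gamma>(1)] norm_mult)
  moreover have "(real s powr (3/2))\<^sup>2 = real s ^ 3"
    using s_pos by (simp add: powr_powr flip: powr_numeral)
  ultimately have "(cmod (C_mat G H D \<gamma> (H #> x) (H #> y)))\<^sup>2 = 1"
    using s_pos D_nonempty by (simp only: C_mat_coset[OF x y] norm_mult power_mult_distrib)
      (simp add: power_divide norm_divide)
  then have "cmod (C_mat G H D \<gamma> (H #> x) (H #> y)) = 1"
    by (metis norm_ge_zero one_power2 power2_eq_imp_eq zero_le_one)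
  then show ?thesis
    using rcos_eq_iff[OF subgroup_H x y] False by simp
qed

lemma sum_cosets_eq:
  fixes F :: "'a set \<Rightarrow> complex"
  shows "of_nat (card H) * (\<Sum>c\<in>carrier (G Mod H). F c) = (\<Sum>x\<in>carrier G. F (H #> x))"
  using sum_rcosets[OF finite_carrier subgroup_H, of F] by (simp add: FactGroup_def)

lemma sum_fiber_carrier:
  "(\<Sum>d\<in>fiber g. F d) = (\<Sum>d\<in>D. of_bool (H #> d = H #> g) * F d)" for F :: "'a \<Rightarrow> complex"
  by (simp add: of_bool_def if_distrib[of "\<lambda>x. x * _"] sum.inter_filter cong: if_cong)

text \<open>Every nonzero difference occurs equally often in \<open>D\<close>, so the inner product of two columns is
  a multiple of the sum of \<open>\<gamma>\<close> over a coset of \<open>H\<close>, which vanishes.\<close>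

lemma C_mat_columns_orthogonal:
  assumes \<gamma>: "\<gamma> \<in> carrier (dual_group G)" "\<gamma> \<notin> annihilator G H"
    and y: "y \<in> carrier G" and z: "z \<in> carrier G" and yz: "H #> y \<noteq> H #> z"
  shows "(\<Sum>c\<in>carrier (G Mod H). cnj (C_mat G H D \<gamma> c (H #> y)) * C_mat G H D \<gamma> c (H #> z)) = 0"
proof -
  let ?k = "complex_of_real (real s powr (3/2) / real (card D))"
  \<comment> \<open>A pair \<open>d\<close>, \<open>d'\<close> meets a common row in the columns of
    \<open>z\<close> and \<open>y\<close> exactly if
    \<open>(d \<otimes> inv d') \<otimes> ?w \<in> H\<close>. Hence the pair contributes through its
    difference alone, as the value of \<open>?F\<close>.\<close>
  let ?w = "z \<otimes> inv y"
  let ?F = "\<lambda>g. of_bool (g \<otimes> ?w \<in> H) * \<gamma> g"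
  have w: "?w \<in> carrier G" "?w \<notin> H"
    using y z yz rcos_eq_iff[OF subgroup_H z y] by auto
  obtain l where l: "\<And>g. g \<in> carrier G \<Longrightarrow> g \<noteq> \<one> \<Longrightarrow> difference_count G D g = l"
    using difference_count_D by blast
  have shift: "H #> d = H #> (x \<otimes> inv u) \<longleftrightarrow> H #> (d \<otimes> u) = H #> x"
    if "d \<in> carrier G" "x \<in> carrier G" "u \<in> carrier G" for d x u
    using that by (simp add: rcos_eq_iff[OF subgroup_H] inv_mult m_ac)
  have "of_nat (card H) * (\<Sum>c\<in>carrier (G Mod H). cnj (C_mat G H D \<gamma> c (H #> y)) * C_mat G H D \<gamma> c (H #> z)) =
      (\<Sum>x\<in>carrier G. cnj (C_mat G H D \<gamma> (H #> x) (H #> y)) * C_mat G H D \<gamma> (H #> x) (H #> z))"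
    by (rule sum_cosets_eq)
  also have "\<dots> = (\<Sum>x\<in>carrier G. \<Sum>d\<in>D. \<Sum>d'\<in>D. ?k * ?k * (\<gamma> d * cnj (\<gamma> d')) *
      (of_bool (H #> (d \<otimes> z) = H #> x) * of_bool (H #> (d' \<otimes> y) = H #> x)))"
  proof (rule sum.cong[OF refl])
    fix x assume x: "x \<in> carrier G"
    have "cnj (C_mat G H D \<gamma> (H #> x) (H #> y)) * C_mat G H D \<gamma> (H #> x) (H #> z) =
        ?k * ?k * ((\<Sum>d\<in>D. of_bool (H #> (d \<otimes> z) = H #> x) * \<gamma> d) *
          cnj (\<Sum>d\<in>D. of_bool (H #> (d \<otimes> y) = H #> x) * \<gamma> d))"
      using x y z by (simp add: C_mat_coset sum_fiber_carrier shift cong: sum.cong)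
    also have "(\<Sum>d\<in>D. of_bool (H #> (d \<otimes> z) = H #> x) * \<gamma> d) *
          cnj (\<Sum>d\<in>D. of_bool (H #> (d \<otimes> y) = H #> x) * \<gamma> d) =
        (\<Sum>d\<in>D. \<Sum>d'\<in>D. (of_bool (H #> (d \<otimes> z) = H #> x) * \<gamma> d) *
          cnj (of_bool (H #> (d' \<otimes> y) = H #> x) * \<gamma> d'))"
      by (simp only: cnj_sum sum_product)
    also have "?k * ?k * \<dots> = (\<Sum>d\<in>D. \<Sum>d'\<in>D. ?k * ?k * (\<gamma> d * cnj (\<gamma> d')) *
      (of_bool (H #> (d \<otimes> z) = H #> x) * of_bool (H #> (d' \<otimes> y) = H #> x)))"
      unfolding sum_distrib_left by (intro sum.cong refl) (simp add: of_bool_def)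
    finally show "cnj (C_mat G H D \<gamma> (H #> x) (H #> y)) * C_mat G H D \<gamma> (H #> x) (H #> z) =
      (\<Sum>d\<in>D. \<Sum>d'\<in>D. ?k * ?k * (\<gamma> d * cnj (\<gamma> d')) *
      (of_bool (H #> (d \<otimes> z) = H #> x) * of_bool (H #> (d' \<otimes> y) = H #> x)))" .
  qed
  also have "\<dots> = (\<Sum>d\<in>D. \<Sum>d'\<in>D. \<Sum>x\<in>carrier G. ?k * ?k * (\<gamma> d * cnj (\<gamma> d')) *
      (of_bool (H #> (d \<otimes> z) = H #> x) * of_bool (H #> (d' \<otimes> y) = H #> x)))"
    by (subst sum.swap, rule sum.cong[OF refl], rule sum.swap)
  also have "\<dots> = (\<Sum>d\<in>D. \<Sum>d'\<in>D. ?k * ?k * of_nat (card H) * ?F (d \<otimes> inv d'))"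
  proof (intro sum.cong refl)
    fix d d' assume d: "d \<in> D" "d' \<in> D"
    have "(\<Sum>x\<in>carrier G. of_bool (H #> (d \<otimes> z) = H #> x) * of_bool (H #> (d' \<otimes> y) = H #> x)) =
      (\<Sum>x\<in>carrier G. complex_of_real (of_bool (H #> (d \<otimes> z) = H #> x)) *
          of_bool (H #> (d \<otimes> z) = H #> (d' \<otimes> y)))"
      by (rule sum.cong) auto
    also have "\<dots> = of_nat (card H) * of_bool (H #> (d \<otimes> z) = H #> (d' \<otimes> y))"
      using sum_of_bool_coset[of "d \<otimes> z"] d z
      by (simp only: sum_distrib_right[symmetric] of_real_sum[symmetric]) simp
    also have "H #> (d \<otimes> z) = H #> (d' \<otimes> y) \<longleftrightarrow> (d \<otimes> inv d') \<otimes> ?w \<in> H"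
      using d y z by (simp add: rcos_eq_iff[OF subgroup_H] inv_mult m_ac)
    finally show "(\<Sum>x\<in>carrier G. ?k * ?k * (\<gamma> d * cnj (\<gamma> d')) *
        (of_bool (H #> (d \<otimes> z) = H #> x) * of_bool (H #> (d' \<otimes> y) = H #> x))) =
        ?k * ?k * of_nat (card H) * ?F (d \<otimes> inv d')"
      using d \<gamma>(1) by (simp only: sum_distrib_left[symmetric] char_mult char_inv D_carrier inv_closed)
        (simp only: mult_ac)
  qed
  also have "\<dots> = ?k * ?k * of_nat (card H) * (\<Sum>d\<in>D. \<Sum>d'\<in>D. ?F (d \<otimes> inv d'))"
    by (simp only: sum_distrib_left)
  \<comment> \<open>The diagonal pairs drop out because \<open>?w \<notin> H\<close> makes
    \<open>?F \<one> = 0\<close>; for the same reason the identity may next be added back to the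
    range.\<close>
  also have "(\<Sum>d\<in>D. \<Sum>d'\<in>D. ?F (d \<otimes> inv d')) = of_nat l * (\<Sum>g\<in>carrier G - {\<one>}. ?F g)"
    using sum_differences_difference_set[OF subgroup_self D_subset l, of ?F] w by simp
  also have "(\<Sum>g\<in>carrier G - {\<one>}. ?F g) = (\<Sum>g\<in>carrier G. ?F g)"
    by (rule sum.mono_neutral_left) (use w in auto)
  \<comment> \<open>Translation by \<open>inv ?w\<close> moves the coset that supports
    \<open>?F\<close> onto \<open>H\<close> and splits off a constant factor.\<close>
  also have "\<dots> = (\<Sum>g\<in>carrier G. ?F (inv ?w \<otimes> g))"
    using w by (subst sum_group_reindex[OF is_group]) auto
  also have "\<dots> = (\<Sum>g\<in>carrier G. \<gamma> (inv ?w) * (if g \<in> H then \<gamma> g else 0))"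
  proof (intro sum.cong refl)
    fix g assume g: "g \<in> carrier G"
    have "inv ?w \<otimes> g \<otimes> ?w = g"
      using w(1) g by (simp add: m_comm[of _ ?w] m_assoc[symmetric])
    then show "?F (inv ?w \<otimes> g) = \<gamma> (inv ?w) * (if g \<in> H then \<gamma> g else 0)"
      using w(1) g \<gamma>(1) by (simp only: char_mult inv_closed) simp
  qed
  also have "\<dots> = \<gamma> (inv ?w) * (\<Sum>g\<in>H. \<gamma> g)"
    using subgroup.subset[OF subgroup_H] by (simp add: sum_distrib_left[symmetric] sum.If_cases Int_absorb1)
  also have "(\<Sum>g\<in>H. \<gamma> g) = 0"
    using \<gamma> sum_char_subgroup_eq_0[OF subgroup_H \<gamma>(1)] by (auto simp: annihilator_def)
  finally show ?thesis
    using card_H_pos by auto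
qed

lemma conference_matrix_C:
  assumes diff: "\<forall>g\<in>carrier G. difference_set (G\<lparr>carrier := H\<rparr>) (shifted_part G H D g)"
    and \<gamma>: "\<gamma> \<in> carrier (dual_group G)" "\<gamma> \<notin> annihilator G H"
  shows "conference_matrix (carrier (G Mod H)) (fine_S G D) (C_mat G H D \<gamma>)"
proof -
  have rep: "\<exists>x\<in>carrier G. c = H #> x" if "c \<in> carrier (G Mod H)" for c
    using that by (auto simp: carrier_FactGroup)
  have norm: "cmod (C_mat G H D \<gamma> c c') = (if c = c' then 0 else 1)"
    if c: "c \<in> carrier (G Mod H)" "c' \<in> carrier (G Mod H)" for c c'
  proof -
    obtain x y where "x \<in> carrier G" "c = H #> x" "y \<in> carrier G" "c' = H #> y"
      using rep[OF c(1)] rep[OF c(2)] by blast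
    then show ?thesis
      using norm_C_mat[OF diff \<gamma>] by blast
  qed
  have "(\<Sum>c\<in>carrier (G Mod H). cnj (C_mat G H D \<gamma> c a) * C_mat G H D \<gamma> c b) =
      (if a = b then complex_of_real (fine_S G D) else 0)"
    if ab: "a \<in> carrier (G Mod H)" "b \<in> carrier (G Mod H)" for a b
  proof (cases "a = b")
    case True
    have fin: "finite (carrier (G Mod H))"
      by (simp add: carrier_FactGroup)
    have "(\<Sum>c\<in>carrier (G Mod H). cnj (C_mat G H D \<gamma> c a) * C_mat G H D \<gamma> c a) =
        (\<Sum>c\<in>carrier (G Mod H). complex_of_real ((cmod (C_mat G H D \<gamma> c a))\<^sup>2))"
      by (simp only: complex_norm_square mult.commute)
    \<comment> \<open>Each column has \<open>s + 1\<close> entries, all of modulus 1 except the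
      diagonal zero, so its squared norm is \<open>s\<close>.\<close>
    also have "\<dots> = (\<Sum>c\<in>carrier (G Mod H). 1 - (if c = a then 1 else 0))"
      using norm ab(1) by (intro sum.cong) auto
    also have "\<dots> = of_nat (card (carrier (G Mod H))) - 1"
      using ab(1) fin by (simp add: sum_subtractf)
    also have "\<dots> = of_nat s"
      using card_cosets by (simp add: FactGroup_def)
    finally show ?thesis
      using True by (simp add: fine_S_eq)
  next
    case False
    then show ?thesis
      using C_mat_columns_orthogonal[OF \<gamma>] rep[OF ab(1)] rep[OF ab(2)] by auto
  qed
  then show ?thesis
    using norm by (simp add: conference_matrix_def mat_eq_def mat_times_def conj_transpose_def scalar_mat_def)
qed

end

theorem theorem3p5:
  fixes G :: "('a, 'b) monoid_scheme" and H D :: "'a set"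
  assumes "comm_group G" and "finite (carrier G)" and "subgroup H G"
    and "fine_difference_set G H D"
  shows
    "(\<forall>\<gamma>\<in>carrier (dual_group G). \<forall>\<gamma>'\<in>carrier (dual_group G).
        diagonal_on (nonzero_cosets G H)
          (mat_times D (conj_transpose (E_mat G H D \<gamma>)) (E_mat G H D \<gamma>')) \<and>
        (\<forall>c\<in>nonzero_cosets G H.
          mat_times D (conj_transpose (E_mat G H D \<gamma>)) (E_mat G H D \<gamma>') c c =
          complex_of_real (fine_S G D / real (card D)) *
            (\<Sum>d | d \<in> D \<and> H #>\<^bsub>G\<^esub> d = c.
               (inv\<^bsub>dual_group G\<^esub> \<gamma> \<otimes>\<^bsub>dual_group G\<^esub> \<gamma>') d))) \<and>
     (\<forall>\<gamma>\<in>carrier (dual_group G).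
        mat_eq (nonzero_cosets G H) (nonzero_cosets G H)
          (mat_times D (conj_transpose (E_mat G H D \<gamma>)) (E_mat G H D \<gamma>)) (scalar_mat 1) \<and>
        mat_eq D (annihilator G H) (Phi_mat D \<gamma>)
          (mat_times (nonzero_cosets G H) (E_mat G H D \<gamma>) (Psi_mat G D))) \<and>
     (eitff D (carrier (dual_group G Mod annihilator G H)) (U_space G H D) \<longleftrightarrow>
        (\<forall>g\<in>carrier G. difference_set (G\<lparr>carrier := H\<rparr>) (shifted_part G H D g))) \<and>
     ((\<forall>g\<in>carrier G. difference_set (G\<lparr>carrier := H\<rparr>) (shifted_part G H D g)) \<and>
        H \<noteq> {\<one>\<^bsub>G\<^esub>} \<longrightarrow>
        (\<exists>s::nat. fine_S G D = real s \<and> s ^ 3 dvd card D ^ 2)) \<and>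
     ((\<forall>g\<in>carrier G. difference_set (G\<lparr>carrier := H\<rparr>) (shifted_part G H D g)) \<longrightarrow>
        (\<forall>\<gamma>\<in>carrier (dual_group G) - annihilator G H.
           circulant (G Mod H) (C_mat G H D \<gamma>) \<and>
           conference_matrix (carrier (G Mod H)) (fine_S G D) (C_mat G H D \<gamma>)))"
proof -
  interpret fine_difference_set_setting G H D
    by (intro fine_difference_set_setting.intro finite_comm_group.intro
        finite_comm_group_axioms.intro fine_difference_set_setting_axioms.intro) fact+
  have circ: "circulant (G Mod H) (C_mat G H D \<gamma>)" for \<gamma>
    unfolding circulant_def C_mat_def
    by (rule exI[of _ "\<lambda>z. complex_of_real (fine_S G D powr (3/2) / real (card D)) *
          (\<Sum>d | d \<in> D \<and> H #>\<^bsub>G\<^esub> d = z. \<gamma> d)"]) simp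
  show ?thesis
  proof (intro conjI)
    show "\<forall>\<gamma>\<in>carrier (dual_group G). \<forall>\<gamma>'\<in>carrier (dual_group G).
        diagonal_on (nonzero_cosets G H)
          (mat_times D (conj_transpose (E_mat G H D \<gamma>)) (E_mat G H D \<gamma>')) \<and>
        (\<forall>c\<in>nonzero_cosets G H.
          mat_times D (conj_transpose (E_mat G H D \<gamma>)) (E_mat G H D \<gamma>') c c =
          complex_of_real (fine_S G D / real (card D)) *
            (\<Sum>d | d \<in> D \<and> H #>\<^bsub>G\<^esub> d = c.
               (inv\<^bsub>dual_group G\<^esub> \<gamma> \<otimes>\<^bsub>dual_group G\<^esub> \<gamma>') d))"
      using E_gram E_gram_diagonal by simp
    show "\<forall>\<gamma>\<in>carrier (dual_group G).
        mat_eq (nonzero_cosets G H) (nonzero_cosets G H)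
          (mat_times D (conj_transpose (E_mat G H D \<gamma>)) (E_mat G H D \<gamma>)) (scalar_mat 1) \<and>
        mat_eq D (annihilator G H) (Phi_mat D \<gamma>)
          (mat_times (nonzero_cosets G H) (E_mat G H D \<gamma>) (Psi_mat G D))"
      using isometry_E Phi_eq_E_Psi unfolding isometry_mat_def by blast
    show "eitff D (carrier (dual_group G Mod annihilator G H)) (U_space G H D) \<longleftrightarrow>
        (\<forall>g\<in>carrier G. difference_set (G\<lparr>carrier := H\<rparr>) (shifted_part G H D g))"
      by (rule eitff_iff_difference_sets)
    show "(\<forall>g\<in>carrier G. difference_set (G\<lparr>carrier := H\<rparr>) (shifted_part G H D g)) \<and>
        H \<noteq> {\<one>\<^bsub>G\<^esub>} \<longrightarrow>
        (\<exists>s::nat. fine_S G D = real s \<and> s ^ 3 dvd card D ^ 2)"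
      using fine_S_eq s_cubed_dvd by blast
    show "(\<forall>g\<in>carrier G. difference_set (G\<lparr>carrier := H\<rparr>) (shifted_part G H D g)) \<longrightarrow>
        (\<forall>\<gamma>\<in>carrier (dual_group G) - annihilator G H.
           circulant (G Mod H) (C_mat G H D \<gamma>) \<and>
           conference_matrix (carrier (G Mod H)) (fine_S G D) (C_mat G H D \<gamma>))"
      using circ conference_matrix_C by blast
  qed
qed

end
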